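(* Let $I_n$ denote the number of isolated vertices of the random Catalan-pair graph $CP_n$, and let $$\gamma = 4\sum_{m=1}^{\infty}16^{-m}\sum_{b=0}^{m-1}\binom{2m-2}{2b}C_{m-1-b}C_b \;(=0.3023\ldots).$$ Then $\mathbb{E}[I_n]\sim \gamma n$ as $n\to\infty$, and for every $\epsilon>0$, $\Pr[\,|I_n-\gamma n|<\epsilon n\,]\to 1$ as $n\to\infty$.
   Context: $C_m=\frac{1}{m+1}\binom{2m}{m}$ is the $m$-th Catalan number. A Catalan-arc matching of size $m$ on $2m$ points $p_1<\dots<p_{2m}$ of a line is a perfect matching of these points with no two arcs crossing, i.e. there are no $a<b<c<d$ with $\{p_a,p_c\}$ and $\{p_b,p_d\}$ both arcs; there are $C_m$ of them. The random Catalan-pair graph $CP_n$: take the points $1,\dots,2n$ on a line; color each of $1,\dots,2n-1$ red or blue independently and uniformly, and color point $2n$ so that the number of red points is even. If there are $2k$ red points, choose independently and uniformly a Catalan-arc matching of size $k$ on the red points and one of size $n-k$ on the blue points. $CP_n$ has one vertex per arc ($n$ vertices), two vertices adjacent iff the endpoints of the two arcs alternate (arcs $\{a,c\},\{b,d\}$ with $a<b<c<d$). *)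

theory Defs
  imports "HOL-Probability.Probability" "HOL-Library.Landau_Symbols"
begin

definition catalan :: "nat \<Rightarrow> real" where
  "catalan m = real ((2*m) choose m) / real (m+1)"

definition perfect_matching :: "nat set \<Rightarrow> nat set set \<Rightarrow> bool" where
  "perfect_matching S M \<longleftrightarrow>
     (\<forall>e\<in>M. \<exists>a b. a < b \<and> e = {a, b}) \<and> \<Union>M = S \<and>
     (\<forall>e\<in>M. \<forall>f\<in>M. e \<noteq> f \<longrightarrow> e \<inter> f = {})"

definition arcs_cross :: "nat set \<Rightarrow> nat set \<Rightarrow> bool" where
  "arcs_cross e f \<longleftrightarrow> (\<exists>a b c d. a < b \<and> b < c \<and> c < d \<and>
     ((e = {a, c} \<and> f = {b, d}) \<or> (e = {b, d} \<and> f = {a, c})))"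

definition noncrossing :: "nat set set \<Rightarrow> bool" where
  "noncrossing M \<longleftrightarrow> (\<forall>e\<in>M. \<forall>f\<in>M. \<not> arcs_cross e f)"

definition catalan_matchings :: "nat set \<Rightarrow> nat set set set" where
  "catalan_matchings S = {M. perfect_matching S M \<and> noncrossing M}"

text \<open>The random Catalan-pair graph CP_n, represented by its set of arcs (= vertices);
  adjacency is given by arcs_cross. Points 1..2n-1 are coloured uniformly at random
  (R0 = red ones), point 2n is red iff needed to make the number of red points even.\<close>
definition CP :: "nat \<Rightarrow> nat set set pmf" where
  "CP n = do {
     R0 \<leftarrow> pmf_of_set (Pow {1..2*n-1});
     let R = (if even (card R0) then R0 else insert (2*n) R0);
     MR \<leftarrow> pmf_of_set (catalan_matchings R);
     MB \<leftarrow> pmf_of_set (catalan_matchings ({1..2*n} - R));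
     return_pmf (MR \<union> MB)
   }"

definition isolated_count :: "nat set set \<Rightarrow> nat" where
  "isolated_count M = card {e\<in>M. \<not> (\<exists>f\<in>M. arcs_cross e f)}"

definition gamma_CP :: real where
  "gamma_CP = 4 * (\<Sum>m. (1/16)^(Suc m) *
      (\<Sum>b\<le>m. real ((2*m) choose (2*b)) * catalan (m - b) * catalan b))"

end

theory Submission
  imports Defs "HOL-Real_Asymp.Real_Asymp"
begin

text \<open>
  An arc with endpoints \<open>i < j\<close> is isolated iff no other arc has exactly one endpoint in
  \<open>{i..j}\<close>. Given the colouring, the matchings for which this holds split into a pair of matchings
  of the window \<open>{i..j}\<close> and a pair of matchings of its complement, so the conditional probability
  is a factor depending only on the colours inside the window times ratios
  \<open>C(k - a) / C(k)\<close> of Catalan numbers, which tend to \<open>4 ^ (-a)\<close>. Since both colour classes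
  are large with high probability, the probabilities of one window, and of two disjoint windows, converge
  uniformly in the positions of the windows, and the second one to the product of the first ones. Hence the
  number of isolated arcs of any fixed length, divided by \<open>n\<close>, converges in \<open>L\<^sup>2\<close>.

  Long isolated arcs are controlled without any uniform estimate: they are no more numerous than the long
  arcs, there are \<open>n\<close> arcs in total, and the limiting densities of the arcs of fixed length add up to
  \<open>1\<close>. Altogether \<open>I / n\<close> converges to \<open>\<gamma>\<close> in \<open>L\<^sup>1\<close>, which gives both claims.
\<close>

section \<open>Catalan numbers and noncrossing matchings\<close>

text \<open>Origin of the constant: in a window of 2m points with 2a red and 2b blue ones, the
  Catalan ratios tend to 4^(-a) and 4^(-b), so their product 4^(-m) does not see how the window is
  coloured; averaging over its colourings contributes another 2^(-2m), which makes 16^(-m). The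
  factor 4 is 2 for the colour of the arc times 2 for the roughly 2n left endpoints per n vertices.
  The binomial and the two Catalan numbers count the coloured completions under the arc. Uniformity
  in the position comes from the fact that colours outside a window enter only through the number of
  red points. The obstacle is that the error bound depends on the window length, so limits cannot be
  summed over all lengths at once. The tail is controlled through all arcs because their number is
  known exactly. Their limiting densities add up to 1 for this reason: an arc over 2a points of its
  own colour can have any length, and summing over the lengths averages out the other colour,
  leaving the terms 2 * C_a * 4^(-(a+1)), whose sum telescopes.\<close>

lemma catalan_0 [simp]: "catalan 0 = 1"
  by (simp add: catalan_def)

text \<open>Two uses of the absorption identity for binomials, linked by the symmetry of row 2k+1.
  The form without division is the one that later sums absorb.\<close>

lemma catalan_Suc: "real (k + 2) * catalan (Suc k) = real (4 * k + 2) * catalan k"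
proof -
  have 1: "Suc k * ((2 * Suc k) choose Suc k) = (2 * Suc k) * ((2 * k + 1) choose k)"
    using Suc_times_binomial_eq[of "2*k+1" k] by (simp add: mult.commute)
  have 2: "Suc k * ((2 * k + 1) choose k) = (2 * k + 1) * ((2 * k) choose k)"
    using Suc_times_binomial_eq[of "2*k" k] binomial_symmetric[of k "2*k+1"]
    by (simp add: mult.commute)
  have "(Suc k * Suc k) * ((2 * Suc k) choose Suc k) = Suc k * (2 * (2 * k + 1) * ((2 * k) choose k))"
    using 1 2 by (metis mult.assoc mult.left_commute)
  then have 3: "Suc k * ((2 * Suc k) choose Suc k) = 2 * (2 * k + 1) * ((2 * k) choose k)"
    by (metis mult.assoc mult_left_cancel nat.distinct(1))
  have "real (Suc k) * real ((2 * Suc k) choose Suc k) = real (4 * k + 2) * real ((2 * k) choose k)"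
    using arg_cong[OF 3, of real] by (simp only: of_nat_mult) (simp add: algebra_simps)
  then have 4: "real ((2 * Suc k) choose Suc k) = real (4 * k + 2) * real ((2 * k) choose k) / real (Suc k)"
    by (simp add: field_simps)
  have "real k + 1 \<noteq> 0" "real k + 2 \<noteq> 0" by linarith+
  then show ?thesis unfolding catalan_def 4 by (simp add: divide_simps)
qed

lemma catalan_pos: "catalan k > 0"
  by (simp add: catalan_def)

lemma catalan_Suc_eq: "catalan (Suc k) = real (4 * k + 2) / real (k + 2) * catalan k"
  using catalan_Suc[of k] by (simp add: field_simps)

text \<open>Multiplying the convolution by the index gives, by symmetry, \<open>n/2\<close> times the convolution;
  with the two-term recursion this determines it inductively.\<close>
lemma catalan_convolution: "(\<Sum>i\<le>n. catalan i * catalan (n - i)) = catalan (Suc n)"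
proof (induction n)
  case 0
  show ?case by (simp add: catalan_def)
next
  case (Suc n)
  define S where "S = (\<lambda>n. \<Sum>i\<le>n. catalan i * catalan (n - i))"
  define T where "T = (\<lambda>n. \<Sum>i\<le>n. real i * (catalan i * catalan (n - i)))"
  have T: "2 * T m = real m * S m" for m
  proof -
    have "T m = (\<Sum>i\<le>m. real (m - i) * (catalan (m - i) * catalan i))"
      unfolding T_def by (subst sum.nat_diff_reindex[symmetric, of _ "Suc m", simplified lessThan_Suc_atMost])
        (rule sum.cong, auto)
    then have "2 * T m = (\<Sum>i\<le>m. real i * (catalan i * catalan (m - i)) + real (m - i) * (catalan (m - i) * catalan i))"
      by (simp add: sum.distrib T_def)
    also have "\<dots> = (\<Sum>i\<le>m. real m * (catalan i * catalan (m - i)))"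
      by (rule sum.cong) (auto simp: of_nat_diff algebra_simps)
    finally show ?thesis by (simp add: S_def sum_distrib_left)
  qed
  \<comment> \<open>The weight i+1 turns into i+2 when the index is shifted, which is the factor
    that \<open>catalan_Suc\<close> rewrites.\<close>
  have "T (Suc n) + S (Suc n) = (\<Sum>i\<le>Suc n. real (i + 1) * (catalan i * catalan (Suc n - i)))"
    by (simp add: T_def S_def sum.distrib algebra_simps)
  also have "\<dots> = catalan (Suc n) + (\<Sum>i\<le>n. (real (i + 2) * catalan (Suc i)) * catalan (n - i))"
    by (subst sum.atMost_Suc_shift) (simp add: algebra_simps)
  also have "\<dots> = catalan (Suc n) + (\<Sum>i\<le>n. (real (4 * i + 2) * catalan i) * catalan (n - i))"
    by (subst catalan_Suc) simp
  also have "\<dots> = catalan (Suc n) + 4 * T n + 2 * S n"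
    by (simp add: T_def S_def sum.distrib algebra_simps sum_distrib_left)
  also have "\<dots> = real (2 * n + 3) * catalan (Suc n)"
  proof -
    have "S n = catalan (Suc n)" using Suc.IH by (simp add: S_def)
    moreover have "2 * T n = real n * S n" by (rule T)
    ultimately show ?thesis by (simp add: algebra_simps)
  qed
  finally have "2 * T (Suc n) + 2 * S (Suc n) = real (4 * n + 6) * catalan (Suc n)"
    by (simp add: algebra_simps)
  then have "real (n + 3) * S (Suc n) = real (4 * n + 6) * catalan (Suc n)"
    unfolding T by (simp add: algebra_simps)
  also have "\<dots> = real (n + 3) * catalan (Suc (Suc n))"
    using catalan_Suc[of "Suc n"] by (simp add: algebra_simps)
  finally show ?case unfolding S_def by simp
qed

lemma catalan_le_Suc: "catalan k \<le> catalan (Suc k)"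
proof -
  have "1 \<le> real (4 * k + 2) / real (k + 2)" by (simp add: field_simps)
  then have "1 * catalan k \<le> real (4 * k + 2) / real (k + 2) * catalan k"
    by (intro mult_right_mono) (auto simp: less_imp_le[OF catalan_pos])
  then show ?thesis by (simp add: catalan_Suc_eq)
qed

lemma catalan_mono: "a \<le> b \<Longrightarrow> catalan a \<le> catalan b"
  by (rule lift_Suc_mono_le[of catalan]) (auto simp: catalan_le_Suc)

section \<open>Cutting noncrossing matchings along intervals\<close>

lemma arcs_cross_iff:
  assumes "a < b" "c < d"
  shows "arcs_cross {a, b} {c, d} \<longleftrightarrow> a < c \<and> c < b \<and> b < d \<or> c < a \<and> a < d \<and> d < b"
proof
  assume "arcs_cross {a, b} {c, d}"
  then show "a < c \<and> c < b \<and> b < d \<or> c < a \<and> a < d \<and> d < b"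
    unfolding arcs_cross_def using assms by (auto simp: doubleton_eq_iff)
next
  assume "a < c \<and> c < b \<and> b < d \<or> c < a \<and> a < d \<and> d < b"
  then show "arcs_cross {a, b} {c, d}"
    unfolding arcs_cross_def by blast
qed

text \<open>\<open>W\<close> need not be spanned by an arc: the notion serves both for the window of
  an isolated arc and for the open interior below an outer arc.\<close>

definition closed_on :: "nat set \<Rightarrow> nat set set \<Rightarrow> bool" where
  "closed_on W M \<longleftrightarrow> (\<forall>e\<in>M. e \<subseteq> W \<or> e \<inter> W = {})"

lemma matching_Union: "perfect_matching S M \<Longrightarrow> \<Union>M = S"
  by (simp add: perfect_matching_def)

lemma matching_arcE:
  assumes "perfect_matching S M" "e \<in> M"
  obtains a b where "a < b" "e = {a, b}" "a \<in> S" "b \<in> S"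
proof -
  obtain a b where "a < b" "e = {a, b}" using assms unfolding perfect_matching_def by meson
  then show thesis using that matching_Union[OF assms(1)] assms(2) by blast
qed

lemma matching_arcs_eqI:
  assumes "perfect_matching S M" "e \<in> M" "f \<in> M" "x \<in> e" "x \<in> f"
  shows "e = f"
proof (rule ccontr)
  assume "e \<noteq> f"
  then have "e \<inter> f = {}" using assms(1-3) unfolding perfect_matching_def by simp
  then show False using assms(4,5) by blast
qed

lemma perfect_matching_Un:
  assumes M: "perfect_matching S M" and N: "perfect_matching T N" and "S \<inter> T = {}"
  shows "perfect_matching (S \<union> T) (M \<union> N)"
  unfolding perfect_matching_def
proof (intro conjI ballI impI)
  have sub: "e \<subseteq> S" if "e \<in> M" for e using that matching_Union[OF M] by blast
  have sub': "e \<subseteq> T" if "e \<in> N" for e using that matching_Union[OF N] by blast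
  fix e assume e: "e \<in> M \<union> N"
  then show "\<exists>a b. a < b \<and> e = {a, b}" by (metis Un_iff matching_arcE M N)
  fix f assume f: "f \<in> M \<union> N" "e \<noteq> f"
  consider "e \<in> M" "f \<in> M" | "e \<in> N" "f \<in> N" | "e \<in> M" "f \<in> N" | "e \<in> N" "f \<in> M" using e f by blast
  then show "e \<inter> f = {}"
  proof cases
    case 1
    then show ?thesis using matching_arcs_eqI[OF M] f(2) by blast
  next
    case 2
    then show ?thesis using matching_arcs_eqI[OF N] f(2) by blast
  next
    case 3
    then show ?thesis using sub[of e] sub'[of f] assms(3) by blast
  next
    case 4
    then show ?thesis using sub[of f] sub'[of e] assms(3) by blast
  qed
next
  show "\<Union>(M \<union> N) = S \<union> T" using matching_Union[OF M] matching_Union[OF N] by simp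
qed

text \<open>Any other arc avoids both \<open>i\<close> and \<open>j\<close>, so having exactly one
  endpoint in the closed interval is the same as crossing. It applies to the union of the two colour
  matchings, whose arcs may cross.\<close>

lemma matching_not_crossing_iff:
  assumes M: "perfect_matching S M" and e: "{i, j} \<in> M" and "i < j"
  shows "\<not> (\<exists>f\<in>M. arcs_cross {i, j} f) \<longleftrightarrow> closed_on {i..j} M"
proof -
  have "\<not> arcs_cross {i, j} f \<longleftrightarrow> f \<subseteq> {i..j} \<or> f \<inter> {i..j} = {}" if f: "f \<in> M" for f
  proof -
    obtain c d where cd: "c < d" "f = {c, d}" using matching_arcE[OF M f] by metis
    show ?thesis
    proof (cases "f = {i, j}")
      case True
      then show ?thesis using \<open>i < j\<close> by (auto simp: arcs_cross_iff)
    next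
      case False
      then have "i \<notin> f" "j \<notin> f" using matching_arcs_eqI[OF M f e] by auto
      then show ?thesis using cd \<open>i < j\<close> by (auto simp: arcs_cross_iff)
    qed
  qed
  then show ?thesis unfolding closed_on_def by blast
qed

lemma catalan_matchingsD:
  assumes "M \<in> catalan_matchings S"
  shows "perfect_matching S M" "noncrossing M" "M \<subseteq> Pow S"
  using assms unfolding catalan_matchings_def perfect_matching_def by auto

lemma finite_catalan_matchings: "finite S \<Longrightarrow> finite (catalan_matchings S)"
  by (rule finite_subset[of _ "Pow (Pow S)"]) (auto dest: catalan_matchingsD)

lemma catalan_matchings_closed_on:
  assumes "M \<in> catalan_matchings S" "{i, j} \<in> M" "i < j"
  shows "closed_on {i..j} M"
  using matching_not_crossing_iff[of S M i j] catalan_matchingsD[OF assms(1)] assms(2,3)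
  unfolding noncrossing_def by blast

lemma catalan_matchings_restrict:
  assumes M: "M \<in> catalan_matchings S" and cl: "closed_on W M"
  shows "M \<inter> Pow W \<in> catalan_matchings (S \<inter> W)" "M - Pow W \<in> catalan_matchings (S - W)"
proof -
  note m = catalan_matchingsD[OF M]
  have U: "\<Union>M = S" by (rule matching_Union[OF m(1)])
  have "\<Union>(M \<inter> Pow W) = S \<inter> W" using U cl unfolding closed_on_def by blast
  then show "M \<inter> Pow W \<in> catalan_matchings (S \<inter> W)"
    using m unfolding catalan_matchings_def perfect_matching_def noncrossing_def by simp
  have "\<Union>(M - Pow W) = S - W" using U cl unfolding closed_on_def by blast
  then show "M - Pow W \<in> catalan_matchings (S - W)"
    using m unfolding catalan_matchings_def perfect_matching_def noncrossing_def by simp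
qed

lemma not_arcs_cross_interval:
  assumes "e \<subseteq> {i..j}" "f \<inter> {i..j} = {}"
  shows "\<not> arcs_cross e f" "\<not> arcs_cross f e"
proof -
  have sym: "arcs_cross f e \<longleftrightarrow> arcs_cross e f" for e f
    unfolding arcs_cross_def by blast
  have "\<not> arcs_cross e f"
  proof
    assume "arcs_cross e f"
    then obtain a b c d where "a < b" "b < c" "c < d" "e = {a, c} \<and> f = {b, d} \<or> e = {b, d} \<and> f = {a, c}"
      unfolding arcs_cross_def by blast
    with assms show False by auto
  qed
  then show "\<not> arcs_cross e f" "\<not> arcs_cross f e" using sym by auto
qed

lemma catalan_matchings_Un:
  assumes M: "M \<in> catalan_matchings (S \<inter> {i..j})" and N: "N \<in> catalan_matchings (S - {i..j})"
  shows "M \<union> N \<in> catalan_matchings S" "closed_on {i..j} (M \<union> N)"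
    "(M \<union> N) \<inter> Pow {i..j} = M" "(M \<union> N) - Pow {i..j} = N"
proof -
  note m = catalan_matchingsD[OF M] and n = catalan_matchingsD[OF N]
  have sub: "e \<subseteq> {i..j}" if "e \<in> M" for e using m(3) that by blast
  have dis: "f \<inter> {i..j} = {}" if "f \<in> N" for f using n(3) that by blast
  \<comment> \<open>An empty arc would count as inside and outside the interval at once;
    nonemptiness makes the two halves recoverable from the union.\<close>
  have ne: "f \<noteq> {}" if "f \<in> N" for f
    using matching_arcE[OF n(1) that] by blast
  have "(S \<inter> {i..j}) \<union> (S - {i..j}) = S" "S \<inter> {i..j} \<inter> (S - {i..j}) = {}" by blast+
  then have "perfect_matching S (M \<union> N)"
    using perfect_matching_Un[OF m(1) n(1)] by (simp only:)
  moreover have "noncrossing (M \<union> N)"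
    unfolding noncrossing_def
    using m(2) n(2) not_arcs_cross_interval[OF sub dis] unfolding noncrossing_def by blast
  ultimately show "M \<union> N \<in> catalan_matchings S" unfolding catalan_matchings_def by simp
  show "closed_on {i..j} (M \<union> N)" using sub dis unfolding closed_on_def by blast
  have NP: "f \<notin> Pow {i..j}" if "f \<in> N" for f
    using dis[OF that] ne[OF that] by blast
  show "(M \<union> N) \<inter> Pow {i..j} = M" "(M \<union> N) - Pow {i..j} = N"
    using sub NP by auto
qed

text \<open>Cutting along an interval and gluing back are mutually inverse, since an arc inside an
  interval cannot cross one that avoids it. \<Psi> sees only the inner half and hence travels with
  the first factor.\<close>

lemma card_closed_matchings:
  "card {M \<in> catalan_matchings S. closed_on {i..j} M \<and> \<Psi> (M \<inter> Pow {i..j})} =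
   card {M \<in> catalan_matchings (S \<inter> {i..j}). \<Psi> M} * card (catalan_matchings (S - {i..j}))"
proof -
  let ?W = "{i..j}"
  have "bij_betw (\<lambda>M. (M \<inter> Pow ?W, M - Pow ?W))
     {M \<in> catalan_matchings S. closed_on ?W M \<and> \<Psi> (M \<inter> Pow ?W)}
     ({M \<in> catalan_matchings (S \<inter> ?W). \<Psi> M} \<times> catalan_matchings (S - ?W))"
  proof (rule bij_betw_byWitness[where f' = "\<lambda>(M, N). M \<union> N"], goal_cases)
    case 1
    show ?case by auto
  next
    case 2
    show ?case
    proof
      fix p assume "p \<in> {M \<in> catalan_matchings (S \<inter> ?W). \<Psi> M} \<times> catalan_matchings (S - ?W)"
      then have p: "fst p \<in> catalan_matchings (S \<inter> ?W)" "snd p \<in> catalan_matchings (S - ?W)" by auto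
      show "((case p of (M, N) \<Rightarrow> M \<union> N) \<inter> Pow ?W, (case p of (M, N) \<Rightarrow> M \<union> N) - Pow ?W) = p"
        by (simp only: split_beta catalan_matchings_Un(3,4)[OF p] prod.collapse)
    qed
  next
    case 3
    show ?case by (auto intro: catalan_matchings_restrict)
  next
    case 4
    show ?case
    proof (rule image_subsetI)
      fix p assume "p \<in> {M \<in> catalan_matchings (S \<inter> ?W). \<Psi> M} \<times> catalan_matchings (S - ?W)"
      then have p: "fst p \<in> catalan_matchings (S \<inter> ?W)" "snd p \<in> catalan_matchings (S - ?W)" "\<Psi> (fst p)"
        by auto
      note u = catalan_matchings_Un[OF p(1,2)]
      show "(case p of (M, N) \<Rightarrow> M \<union> N) \<in> {M \<in> catalan_matchings S. closed_on ?W M \<and> \<Psi> (M \<inter> Pow ?W)}"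
        by (simp only: split_beta mem_Collect_eq u p simp_thms)
    qed
  qed
  then show ?thesis by (simp add: bij_betw_same_card card_cartesian_product)
qed

lemma catalan_matchings_empty [simp]: "catalan_matchings {} = {{}}"
  unfolding catalan_matchings_def perfect_matching_def noncrossing_def by auto

lemma catalan_matchings_doubleton:
  assumes "i < j"
  shows "catalan_matchings {i, j} = {{{i, j}}}"
proof (intro equalityI subsetI)
  fix M assume M: "M \<in> catalan_matchings {i, j}"
  note m = catalan_matchingsD[OF M]
  have "e = {i, j}" if "e \<in> M" for e
    using matching_arcE[OF m(1) that] by auto
  moreover have "M \<noteq> {}" using m(1) unfolding perfect_matching_def by auto
  ultimately show "M \<in> {{{i, j}}}" by auto
next
  fix M assume "M \<in> {{{i, j}}}"
  then show "M \<in> catalan_matchings {i, j}"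
    using assms unfolding catalan_matchings_def perfect_matching_def noncrossing_def
    by (auto simp: arcs_cross_iff)
qed

text \<open>Within the window, containing the outer arc is equivalent to the open interior being
  closed, so the cutting bijection applies once more, with a two-point outer part.\<close>

lemma card_matchings_outer_arc:
  assumes "i < j" "P \<subseteq> {i..j}"
  shows "card {M \<in> catalan_matchings P. {i, j} \<in> M} =
    (if i \<in> P \<and> j \<in> P then card (catalan_matchings (P - {i, j})) else 0)"
proof (cases "i \<in> P \<and> j \<in> P")
  case False
  then have "{M \<in> catalan_matchings P. {i, j} \<in> M} = {}"
    using catalan_matchingsD(3) by blast
  then show ?thesis using False by (simp only: card.empty if_False)
next
  case True
  let ?W = "{Suc i..j - 1}"
  have iff: "{i, j} \<in> M \<longleftrightarrow> closed_on ?W M" if M: "M \<in> catalan_matchings P" for M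
  proof
    note m = catalan_matchingsD[OF M]
    assume e: "{i, j} \<in> M"
    show "closed_on ?W M" unfolding closed_on_def
    proof
      fix f assume f: "f \<in> M"
      show "f \<subseteq> ?W \<or> f \<inter> ?W = {}"
      proof (cases "f = {i, j}")
        case True
        then show ?thesis by auto
      next
        case False
        then have "i \<notin> f" "j \<notin> f" using matching_arcs_eqI[OF m(1) f e] by auto
        moreover have "f \<subseteq> {i..j}" using m(3) f assms by blast
        ultimately have "x \<in> ?W" if "x \<in> f" for x
          using that by (cases "x = i"; cases "x = j") (auto simp: subset_iff)
        then have "f \<subseteq> ?W" by blast
        then show ?thesis by blast
      qed
    qed
  next
    note m = catalan_matchingsD[OF M]
    assume cl: "closed_on ?W M"
    \<comment> \<open>The arc at \<open>i\<close> has an endpoint outside the interior, hence avoids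
      it entirely; in \<open>P\<close> only \<open>j\<close> remains as partner.\<close>
    obtain e where e: "e \<in> M" "i \<in> e"
      using True matching_Union[OF m(1)] by blast
    then have d: "e \<inter> ?W = {}" using cl unfolding closed_on_def by fastforce
    obtain a b where ab: "a < b" "e = {a, b}" "a \<in> P" "b \<in> P" using matching_arcE[OF m(1) e(1)] .
    have "e = {i, j}" using ab d e(2) assms by (force simp: subset_iff)
    then show "{i, j} \<in> M" using e by simp
  qed
  have "{M \<in> catalan_matchings P. {i, j} \<in> M} = {M \<in> catalan_matchings P. closed_on ?W M \<and> True}"
    using iff by blast
  then have "card {M \<in> catalan_matchings P. {i, j} \<in> M} =
      card (catalan_matchings (P \<inter> ?W)) * card (catalan_matchings (P - ?W))"
    using card_closed_matchings[of P "Suc i" "j - 1" "\<lambda>_. True"] by simp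
  moreover have "P - ?W = {i, j}" "P \<inter> ?W = P - {i, j}" using True assms by (auto simp: subset_iff)
  ultimately show ?thesis using True assms(1) by (simp add: catalan_matchings_doubleton)
qed

text \<open>An arc of a noncrossing matching closes its own interval, so one can cut there first and
  then at the interior.\<close>

lemma card_matchings_containing_arc:
  assumes "i < j"
  shows "card {M \<in> catalan_matchings S. {i, j} \<in> M} =
    (if i \<in> S \<and> j \<in> S then card (catalan_matchings (S \<inter> {i..j} - {i, j})) * card (catalan_matchings (S - {i..j})) else 0)"
proof -
  have "{M \<in> catalan_matchings S. {i, j} \<in> M} =
      {M \<in> catalan_matchings S. closed_on {i..j} M \<and> {i, j} \<in> M \<inter> Pow {i..j}}"
    using assms catalan_matchings_closed_on[OF _ _ assms] by (intro Collect_cong) auto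
  also have "card \<dots> = card {M \<in> catalan_matchings (S \<inter> {i..j}). {i, j} \<in> M} * card (catalan_matchings (S - {i..j}))"
    by (rule card_closed_matchings)
  also have "card {M \<in> catalan_matchings (S \<inter> {i..j}). {i, j} \<in> M} =
      (if i \<in> S \<and> j \<in> S then card (catalan_matchings (S \<inter> {i..j} - {i, j})) else 0)"
    by (subst card_matchings_outer_arc) (use assms in auto)
  finally show ?thesis by (simp only: if_distrib[of "\<lambda>x. x * _"] mult_zero_left)
qed

section \<open>Catalan numbers count noncrossing matchings\<close>

lemma matching_card:
  assumes M: "perfect_matching S M" and "finite S"
  shows "card S = 2 * card M"
proof -
  have U: "\<Union>M = S" by (rule matching_Union[OF M])
  then have "finite M" using \<open>finite S\<close> by (simp add: finite_UnionD)
  have "card (\<Union>M) = (\<Sum>e\<in>M. card e)"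
    by (rule card_Union_disjoint)
      (use M \<open>finite S\<close> in \<open>auto simp: perfect_matching_def pairwise_def disjnt_def\<close>)
  also have "\<dots> = (\<Sum>e\<in>M. 2)"
    by (rule sum.cong) (auto elim: matching_arcE[OF M])
  finally show ?thesis using U by simp
qed

lemma card_catalan_matchings_odd:
  assumes "finite S" "odd (card S)"
  shows "catalan_matchings S = {}"
proof (rule equals0I)
  fix M assume "M \<in> catalan_matchings S"
  from matching_card[OF catalan_matchingsD(1)[OF this] assms(1)] assms(2) show False by simp
qed

text \<open>Classify by the partner \<open>t\<close> of the smallest point: the points between them
  and those beyond \<open>t\<close> are matched separately, which yields the Catalan
  convolution.\<close>

lemma card_catalan_matchings_even:
  "finite S \<Longrightarrow> card S = 2 * k \<Longrightarrow> real (card (catalan_matchings S)) = catalan k"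
proof (induction k arbitrary: S rule: less_induct)
  case (less k)
  show ?case
  proof (cases k)
    case 0
    then show ?thesis using less.prems by simp
  next
    case (Suc m)
    define s where "s = Min S"
    have "S \<noteq> {}" using Suc less.prems by auto
    then have s: "s \<in> S" "\<And>t. t \<in> S \<Longrightarrow> s \<le> t" using less.prems by (auto simp: s_def)
    define T where "T = S - {s}"
    have T: "finite T" "card T = 2 * m + 1" "\<And>t. t \<in> T \<Longrightarrow> s < t"
      using less.prems Suc s by (auto simp: T_def le_neq_implies_less)
    \<comment> \<open>The rank counts the points strictly between \<open>s\<close> and
      \<open>t\<close>. It replaces the positions in \<open>T\<close> by 0..2m; odd ranks leave an
      unmatchable odd set.\<close>
    define r where "r = (\<lambda>t. card (T \<inter> {..<t}))"
    have rlt: "r t < 2 * m + 1" if "t \<in> T" for t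
      unfolding r_def T(2)[symmetric] by (rule psubset_card_mono) (use that T in auto)
    have rmono: "r t < r u" if "t \<in> T" "t < u" for t u
      unfolding r_def by (rule psubset_card_mono) (use that T in auto)
    then have "inj_on r T" by (intro inj_onI) (metis less_irrefl linorder_neqE_nat)
    moreover have "r ` T \<subseteq> {..<2 * m + 1}" using rlt by auto
    ultimately have rbij: "bij_betw r T {..<2 * m + 1}"
      using T by (simp add: bij_betw_def card_image card_subset_eq)
    have cnt: "real (card {M \<in> catalan_matchings S. {s, t} \<in> M}) =
        (if even (r t) then catalan (r t div 2) * catalan (m - r t div 2) else 0)" if t: "t \<in> T" for t
    proof -
      have "S \<inter> {s..t} - {s, t} = T \<inter> {..<t}" using T(3) less_imp_le[OF T(3)] by (auto simp: T_def)
      moreover have 1: "S - {s..t} = T - (T \<inter> {..<t}) - {t}" using s T(3) t by (auto simp: T_def)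
      moreover have 2: "card (T - (T \<inter> {..<t}) - {t}) = 2 * m - r t"
        using T t by (simp add: r_def card_Diff_subset)
      ultimately have e: "real (card {M \<in> catalan_matchings S. {s, t} \<in> M}) =
         real (card (catalan_matchings (T \<inter> {..<t}))) * real (card (catalan_matchings (S - {s..t})))"
        using card_matchings_containing_arc[OF T(3)[OF t], of S] s t by (simp add: T_def)
      show ?thesis
      proof (cases "even (r t)")
        case False
        then have "catalan_matchings (T \<inter> {..<t}) = {}"
          using T by (intro card_catalan_matchings_odd) (auto simp: r_def)
        then show ?thesis using e False by simp
      next
        case True
        have "real (card (catalan_matchings (T \<inter> {..<t}))) = catalan (r t div 2)"
          by (rule less.IH) (use T True rlt[OF t] Suc in \<open>auto simp: r_def\<close>)
        moreover have "real (card (catalan_matchings (S - {s..t}))) = catalan (m - r t div 2)"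
          by (rule less.IH) (use T True rlt[OF t] Suc 1 2 less.prems in \<open>auto simp: algebra_simps\<close>)
        ultimately show ?thesis using e True by simp
      qed
    qed
    have "catalan_matchings S = (\<Union>t\<in>T. {M \<in> catalan_matchings S. {s, t} \<in> M})"
    proof (intro equalityI subsetI)
      fix M assume M: "M \<in> catalan_matchings S"
      note m = catalan_matchingsD[OF M]
      obtain e where e: "e \<in> M" "s \<in> e" using matching_Union[OF m(1)] s by blast
      obtain a b where ab: "a < b" "e = {a, b}" "a \<in> S" "b \<in> S" using matching_arcE[OF m(1) e(1)] .
      then have "a = s" using s(2)[of a] e(2) by auto
      then have "b \<in> T" "{s, b} \<in> M" using ab e by (auto simp: T_def)
      then show "M \<in> (\<Union>t\<in>T. {M \<in> catalan_matchings S. {s, t} \<in> M})" using M by blast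
    qed auto
    then have "card (catalan_matchings S) = card (\<Union>t\<in>T. {M \<in> catalan_matchings S. {s, t} \<in> M})"
      by simp
    also have "\<dots> = (\<Sum>t\<in>T. card {M \<in> catalan_matchings S. {s, t} \<in> M})"
    proof (rule card_UN_disjoint)
      show "\<forall>t\<in>T. finite {M \<in> catalan_matchings S. {s, t} \<in> M}"
        using finite_catalan_matchings less.prems by auto
      show "\<forall>t\<in>T. \<forall>u\<in>T. t \<noteq> u \<longrightarrow>
          {M \<in> catalan_matchings S. {s, t} \<in> M} \<inter> {M \<in> catalan_matchings S. {s, u} \<in> M} = {}"
      proof (intro ballI impI equals0I)
        fix t u M assume tu: "t \<noteq> u" and
          "M \<in> {M \<in> catalan_matchings S. {s, t} \<in> M} \<inter> {M \<in> catalan_matchings S. {s, u} \<in> M}"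
        then have "{s, t} = {s, u}"
          using matching_arcs_eqI[OF catalan_matchingsD(1), of M S "{s, t}" "{s, u}" s] by blast
        then show False using tu by (auto simp: doubleton_eq_iff)
      qed
    qed (use T in auto)
    finally have "real (card (catalan_matchings S)) =
        (\<Sum>t\<in>T. if even (r t) then catalan (r t div 2) * catalan (m - r t div 2) else 0)"
      using cnt by simp
    also have "\<dots> = (\<Sum>x<2 * m + 1. if even x then catalan (x div 2) * catalan (m - x div 2) else 0)"
      by (rule sum.reindex_bij_betw[OF rbij])
    also have "\<dots> = (\<Sum>x | x < 2 * m + 1 \<and> even x. catalan (x div 2) * catalan (m - x div 2))"
      by (subst sum.inter_filter[symmetric]) (auto intro!: sum.cong)
    also have "\<dots> = (\<Sum>i\<le>m. catalan i * catalan (m - i))"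
      by (rule sum.reindex_bij_witness[of _ "\<lambda>i. 2 * i" "\<lambda>x. x div 2"]) auto
    finally show ?thesis using Suc catalan_convolution by simp
  qed
qed

section \<open>Isolated arcs in pairs of matchings\<close>

text \<open>Phrased through the window instead of through crossings because this form survives the
  removal of a disjoint window.\<close>

definition iso_arc :: "nat \<Rightarrow> nat \<Rightarrow> nat set set \<Rightarrow> bool" where
  "iso_arc i j M \<longleftrightarrow> {i, j} \<in> M \<and> closed_on {i..j} M"

definition matching_pairs :: "nat set \<Rightarrow> nat set \<Rightarrow> (nat set set \<times> nat set set) set" where
  "matching_pairs R B = catalan_matchings R \<times> catalan_matchings B"

lemma closed_on_Un: "closed_on W (M \<union> N) \<longleftrightarrow> closed_on W M \<and> closed_on W N"
  unfolding closed_on_def by blast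

text \<open>Both colours are cut along the same interval. The event \<Phi> has to be readable from
  the arcs outside: it is trivial for one window, and the isolation of the other arc for
  two.\<close>

lemma card_matching_pairs_iso_arc:
  assumes \<Phi>: "\<And>M. iso_arc i j M \<Longrightarrow> \<Phi> M \<longleftrightarrow> \<Phi> (M - Pow {i..j})" and "i < j"
  shows "card {p \<in> matching_pairs R B. iso_arc i j (fst p \<union> snd p) \<and> \<Phi> (fst p \<union> snd p)} =
    card {p \<in> matching_pairs (R \<inter> {i..j}) (B \<inter> {i..j}). {i, j} \<in> fst p \<union> snd p} *
    card {p \<in> matching_pairs (R - {i..j}) (B - {i..j}). \<Phi> (fst p \<union> snd p)}"
proof -
  let ?W = "{i..j}"
  let ?X = "{p \<in> matching_pairs (R \<inter> ?W) (B \<inter> ?W). {i, j} \<in> fst p \<union> snd p}"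
  let ?Y = "{p \<in> matching_pairs (R - ?W) (B - ?W). \<Phi> (fst p \<union> snd p)}"
  let ?Z = "{p \<in> matching_pairs R B. iso_arc i j (fst p \<union> snd p) \<and> \<Phi> (fst p \<union> snd p)}"
  let ?f = "\<lambda>(p, q). (fst p \<union> fst q, snd p \<union> snd q)"
  let ?g = "\<lambda>r. ((fst r \<inter> Pow ?W, snd r \<inter> Pow ?W), (fst r - Pow ?W, snd r - Pow ?W))"
  have "bij_betw ?f (?X \<times> ?Y) ?Z"
  proof (rule bij_betw_byWitness[where f' = ?g])
    show "\<forall>x\<in>?X \<times> ?Y. ?g (?f x) = x"
    proof
      fix x assume x: "x \<in> ?X \<times> ?Y"
      obtain a b c d where [simp]: "x = ((a, b), (c, d))" by (metis prod.collapse)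
      have *: "a \<in> catalan_matchings (R \<inter> ?W)" "c \<in> catalan_matchings (R - ?W)"
        "b \<in> catalan_matchings (B \<inter> ?W)" "d \<in> catalan_matchings (B - ?W)"
        using x by (simp_all add: matching_pairs_def)
      show "?g (?f x) = x"
        using catalan_matchings_Un(3,4)[OF *(1,2)] catalan_matchings_Un(3,4)[OF *(3,4)] by simp
    qed
    show "\<forall>r\<in>?Z. ?f (?g r) = r" by auto
    show "?f ` (?X \<times> ?Y) \<subseteq> ?Z"
    proof (rule image_subsetI)
      fix x assume x: "x \<in> ?X \<times> ?Y"
      obtain a b c d where [simp]: "x = ((a, b), (c, d))" by (metis prod.collapse)
      have *: "a \<in> catalan_matchings (R \<inter> ?W)" "c \<in> catalan_matchings (R - ?W)"
        "b \<in> catalan_matchings (B \<inter> ?W)" "d \<in> catalan_matchings (B - ?W)"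
        using x by (simp_all add: matching_pairs_def)
      have ph: "{i, j} \<in> a \<union> b" "\<Phi> (c \<union> d)" using x by simp_all
      note u = catalan_matchings_Un[OF *(1,2)] and v = catalan_matchings_Un[OF *(3,4)]
      have iso: "iso_arc i j ((a \<union> c) \<union> (b \<union> d))"
        unfolding iso_arc_def closed_on_Un[of _ "a \<union> c"] using u(2) v(2) ph(1) by blast
      have "(a \<union> c) \<union> (b \<union> d) - Pow ?W = c \<union> d" using u(4) v(4) by blast
      then have "\<Phi> ((a \<union> c) \<union> (b \<union> d))" using \<Phi>[OF iso] ph(2) by simp
      then show "?f x \<in> ?Z" using iso u(1) v(1) by (simp add: matching_pairs_def)
    qed
    show "?g ` ?Z \<subseteq> ?X \<times> ?Y"
    proof (rule image_subsetI)
      fix r assume r: "r \<in> ?Z"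
      obtain M N where [simp]: "r = (M, N)" by (metis prod.collapse)
      have m: "M \<in> catalan_matchings R" "N \<in> catalan_matchings B"
        and iso: "iso_arc i j (M \<union> N)" and ph: "\<Phi> (M \<union> N)"
        using r by (simp_all add: matching_pairs_def)
      have cl: "closed_on ?W M" "closed_on ?W N" "{i, j} \<in> M \<union> N"
        using iso unfolding iso_arc_def closed_on_Un by blast+
      have "{i, j} \<in> (M \<inter> Pow ?W) \<union> (N \<inter> Pow ?W)" using cl(3) \<open>i < j\<close> by auto
      moreover have "\<Phi> ((M - Pow ?W) \<union> (N - Pow ?W))"
        using \<Phi>[OF iso] ph by (simp add: Un_Diff)
      ultimately show "?g r \<in> ?X \<times> ?Y"
        using catalan_matchings_restrict[OF m(1) cl(1)] catalan_matchings_restrict[OF m(2) cl(2)]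
        by (simp add: matching_pairs_def)
    qed
  qed
  then show ?thesis by (simp only: bij_betw_same_card[symmetric] card_cartesian_product)
qed

text \<open>Arcs inside a disjoint window neither are the second arc nor meet its window. This is
  the hypothesis on \<Phi> needed for two windows.\<close>

lemma iso_arc_Diff_Pow:
  assumes "{i..j} \<inter> {i'..j'} = {}" "i' < j'"
  shows "iso_arc i' j' M \<longleftrightarrow> iso_arc i' j' (M - Pow {i..j})"
proof -
  have "i' \<notin> {i..j}" using assms by auto
  then have "{i', j'} \<notin> Pow {i..j}" by blast
  moreover have "e \<inter> {i'..j'} = {}" if "e \<in> Pow {i..j}" for e using that assms(1) by blast
  ultimately show ?thesis unfolding iso_arc_def closed_on_def by blast
qed

section \<open>Counts for one and for two isolated arcs\<close>

definition n_matchings :: "nat set \<Rightarrow> real" where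
  "n_matchings S = real (card (catalan_matchings S))"

text \<open>The local factor of the conditional probability: \<open>P\<close> is the red part of the
  window, and the rest of the window is blue.\<close>

definition iso_weight :: "nat \<Rightarrow> nat \<Rightarrow> nat set \<Rightarrow> real" where
  "iso_weight i j P = real (card {p \<in> matching_pairs P ({i..j} - P). {i, j} \<in> fst p \<union> snd p})"

lemma n_matchings_eq:
  "finite S \<Longrightarrow> n_matchings S = (if even (card S) then catalan (card S div 2) else 0)"
  using card_catalan_matchings_even[of S "card S div 2"] card_catalan_matchings_odd[of S]
  by (auto simp: n_matchings_def)

lemma card_matching_pairs: "real (card (matching_pairs R B)) = n_matchings R * n_matchings B"
  by (simp add: matching_pairs_def n_matchings_def card_cartesian_product)

lemma finite_matching_pairs: "finite R \<Longrightarrow> finite B \<Longrightarrow> finite (matching_pairs R B)"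
  by (simp add: matching_pairs_def finite_catalan_matchings)

text \<open>The two cases exclude each other because an arc cannot lie in two disjoint colour
  classes.\<close>

lemma card_matching_pairs_arc:
  assumes "finite R" "finite B" "R \<inter> B = {}"
  shows "real (card {p \<in> matching_pairs R B. {i, j} \<in> fst p \<union> snd p}) =
    real (card {M \<in> catalan_matchings R. {i, j} \<in> M}) * n_matchings B +
    n_matchings R * real (card {M \<in> catalan_matchings B. {i, j} \<in> M})"
proof -
  have *: "{p \<in> matching_pairs R B. {i, j} \<in> fst p \<union> snd p} =
      {M \<in> catalan_matchings R. {i, j} \<in> M} \<times> catalan_matchings B \<union>
      catalan_matchings R \<times> {M \<in> catalan_matchings B. {i, j} \<in> M}"
    unfolding matching_pairs_def by auto
  have no: "\<not> ({i, j} \<in> M \<and> {i, j} \<in> N)" if "M \<in> catalan_matchings R" "N \<in> catalan_matchings B" for M N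
    using catalan_matchingsD(3)[OF that(1)] catalan_matchingsD(3)[OF that(2)] assms(3) by blast
  show ?thesis
    unfolding * by (subst card_Un_disjoint)
      (use assms no in \<open>auto simp: card_cartesian_product n_matchings_def finite_catalan_matchings\<close>)
qed

lemma iso_weight_eq:
  assumes "i < j" "P \<subseteq> {i..j}"
  shows "iso_weight i j P =
    (if i \<in> P \<and> j \<in> P then n_matchings (P - {i, j}) * n_matchings ({i..j} - P) else 0) +
    (if i \<notin> P \<and> j \<notin> P then n_matchings P * n_matchings ({i..j} - P - {i, j}) else 0)"
proof -
  let ?Q = "{i..j} - P"
  have "finite P" using assms(2) by (rule finite_subset) simp
  then have "iso_weight i j P = real (card {M \<in> catalan_matchings P. {i, j} \<in> M}) * n_matchings ?Q +
      n_matchings P * real (card {M \<in> catalan_matchings ?Q. {i, j} \<in> M})"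
    unfolding iso_weight_def by (intro card_matching_pairs_arc) auto
  moreover have "real (card {M \<in> catalan_matchings P. {i, j} \<in> M}) =
      (if i \<in> P \<and> j \<in> P then n_matchings (P - {i, j}) else 0)"
    by (subst card_matchings_outer_arc[OF assms]) (simp add: n_matchings_def)
  moreover have "real (card {M \<in> catalan_matchings ?Q. {i, j} \<in> M}) =
      (if i \<notin> P \<and> j \<notin> P then n_matchings (?Q - {i, j}) else 0)"
    by (subst card_matchings_outer_arc[OF assms(1)]) (use assms(1) in \<open>auto simp: n_matchings_def\<close>)
  ultimately show ?thesis by simp
qed

lemma count_iso_arc:
  assumes "i < j" "{i..j} \<subseteq> V"
  shows "real (card {p \<in> matching_pairs R (V - R). iso_arc i j (fst p \<union> snd p)}) =
    iso_weight i j (R \<inter> {i..j}) * (n_matchings (R - {i..j}) * n_matchings (V - R - {i..j}))"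
proof -
  have "(V - R) \<inter> {i..j} = {i..j} - R \<inter> {i..j}" using assms by blast
  then show ?thesis
    using card_matching_pairs_iso_arc[of i j "\<lambda>_. True" R "V - R"] assms(1)
    by (simp add: iso_weight_def card_matching_pairs)
qed

text \<open>The first window is cut out, and the one-window count is applied to the remaining
  points; this is why \<open>count_iso_arc\<close> allows an arbitrary ground set
  \<open>V\<close>.\<close>

lemma count_iso_arc_pair:
  assumes "i < j" "{i..j} \<subseteq> V" "i' < j'" "{i'..j'} \<subseteq> V" and disj: "{i..j} \<inter> {i'..j'} = {}"
  shows "real (card {p \<in> matching_pairs R (V - R). iso_arc i j (fst p \<union> snd p) \<and> iso_arc i' j' (fst p \<union> snd p)}) =
    (iso_weight i j (R \<inter> {i..j}) * iso_weight i' j' (R \<inter> {i'..j'})) *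
    (n_matchings (R - ({i..j} \<union> {i'..j'})) * n_matchings (V - R - ({i..j} \<union> {i'..j'})))"
proof -
  have e: "(V - R) \<inter> {i..j} = {i..j} - R \<inter> {i..j}" "V - R - {i..j} = (V - {i..j}) - (R - {i..j})"
    "R - {i..j} - {i'..j'} = R - ({i..j} \<union> {i'..j'})"
    "(V - {i..j}) - (R - {i..j}) - {i'..j'} = V - R - ({i..j} \<union> {i'..j'})"
    "(R - {i..j}) \<inter> {i'..j'} = R \<inter> {i'..j'}"
    using assms by blast+
  have "real (card {p \<in> matching_pairs R (V - R). iso_arc i j (fst p \<union> snd p) \<and> iso_arc i' j' (fst p \<union> snd p)}) =
    iso_weight i j (R \<inter> {i..j}) *
    real (card {p \<in> matching_pairs (R - {i..j}) ((V - {i..j}) - (R - {i..j})). iso_arc i' j' (fst p \<union> snd p)})"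
    using card_matching_pairs_iso_arc[of i j "iso_arc i' j'" R "V - R"] assms(1) iso_arc_Diff_Pow[OF disj assms(3)]
    unfolding e(1,2) by (simp add: iso_weight_def)
  also have "\<dots> = iso_weight i j (R \<inter> {i..j}) * (iso_weight i' j' (R \<inter> {i'..j'}) *
    (n_matchings (R - ({i..j} \<union> {i'..j'})) * n_matchings (V - R - ({i..j} \<union> {i'..j'}))))"
    by (subst count_iso_arc) (use assms in \<open>auto simp: e\<close>)
  finally show ?thesis by (simp add: mult.assoc)
qed

lemma iso_weight_nonneg: "iso_weight i j P \<ge> 0"
  by (simp add: iso_weight_def)

text \<open>A positive weight means that both colours can be matched inside the window. The parity
  is what turns quotients of matching numbers into \<open>rho\<close>.\<close>

lemma iso_weight_even:
  assumes "iso_weight i j P \<noteq> 0" "P \<subseteq> {i..j}"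
  shows "even (card P)" "even (card ({i..j} - P))"
proof -
  have "finite P" using assms(2) by (rule finite_subset) simp
  obtain p where "p \<in> matching_pairs P ({i..j} - P)"
    using assms(1) unfolding iso_weight_def by (metis (no_types, lifting) card.empty empty_Collect_eq of_nat_0)
  then have "catalan_matchings P \<noteq> {}" "catalan_matchings ({i..j} - P) \<noteq> {}"
    unfolding matching_pairs_def by auto
  then show "even (card P)" "even (card ({i..j} - P))"
    using card_catalan_matchings_odd \<open>finite P\<close> by blast+
qed

lemma n_matchings_nonneg: "n_matchings S \<ge> 0"
  by (simp add: n_matchings_def)

lemma n_matchings_le: 
  assumes "finite S" "card S \<le> 2 * k"
  shows "n_matchings S \<le> catalan k"
  using assms catalan_mono[of "card S div 2" k] less_imp_le[OF catalan_pos[of k]]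
  by (simp add: n_matchings_eq)

text \<open>A crude bound; what matters is that it depends on the length of the window and not on
  its position.\<close>

lemma iso_weight_le:
  assumes "P \<subseteq> {i..j}"
  shows "iso_weight i j P \<le> (catalan (Suc j - i))\<^sup>2"
proof -
  have fP: "finite P" using assms by (rule finite_subset) simp
  have "card P \<le> card {i..j}" "card ({i..j} - P) \<le> card {i..j}"
    using assms by (intro card_mono; blast)+
  then have c: "card P \<le> 2 * (Suc j - i)" "card ({i..j} - P) \<le> 2 * (Suc j - i)" by simp_all
  have "iso_weight i j P \<le> real (card (matching_pairs P ({i..j} - P)))"
    unfolding iso_weight_def using fP by (intro of_nat_mono card_mono finite_matching_pairs) auto
  also have "\<dots> \<le> catalan (Suc j - i) * catalan (Suc j - i)"
    unfolding card_matching_pairs using fP c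
    by (intro mult_mono n_matchings_le) (auto simp: n_matchings_nonneg less_imp_le[OF catalan_pos])
  finally show ?thesis by (simp add: power2_eq_square)
qed

section \<open>Averages over random colourings\<close>

text \<open>The possible red sets of the model; the blue set is then even as well.\<close>

definition even_subsets :: "nat \<Rightarrow> nat set set" where
  "even_subsets n = {R. R \<subseteq> {1..2*n} \<and> even (card R)}"

definition avg :: "nat \<Rightarrow> (nat set \<Rightarrow> real) \<Rightarrow> real" where
  "avg n F = (\<Sum>R\<in>even_subsets n. F R) / 2 ^ (2*n - 1)"

lemma finite_even_subsets: "finite (even_subsets n)"
  by (rule finite_subset[of _ "Pow {1..2*n}"]) (auto simp: even_subsets_def)

lemma even_subsets_finite: "R \<in> even_subsets n \<Longrightarrow> finite R"
  unfolding even_subsets_def by (auto intro: finite_subset)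

lemma card_complement_even_subset:
  assumes "R \<in> even_subsets n"
  shows "{1..2*n} - R \<in> even_subsets n" "card ({1..2*n} - R) div 2 = n - card R div 2"
    "card R \<le> 2 * n"
proof -
  have R: "R \<subseteq> {1..2*n}" "even (card R)" "finite R"
    using assms even_subsets_finite[OF assms] by (simp_all add: even_subsets_def)
  have c: "card ({1..2*n} - R) = 2 * n - card R" using R by (simp add: card_Diff_subset)
  show le: "card R \<le> 2 * n" using card_mono[OF _ R(1)] by simp
  show "{1..2*n} - R \<in> even_subsets n" using R(2) c le by (simp add: even_subsets_def)
  show "card ({1..2*n} - R) div 2 = n - card R div 2" using c R(2) le by presburger
qed

text \<open>Swapping the colours preserves the parity, as the number of points is even. Statements
  about red thereby carry over to blue.\<close>

lemma avg_complement: "avg n (\<lambda>R. F ({1..2*n} - R)) = avg n F"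
proof -
  have "(\<Sum>R\<in>even_subsets n. F ({1..2*n} - R)) = (\<Sum>R\<in>even_subsets n. F R)"
    by (rule sum.reindex_bij_witness[of _ "\<lambda>R. {1..2*n} - R" "\<lambda>R. {1..2*n} - R"])
      (simp_all only: card_complement_even_subset(1), auto simp: even_subsets_def)
  then show ?thesis by (simp add: avg_def)
qed

lemma avg_mono: "(\<And>R. R \<in> even_subsets n \<Longrightarrow> F R \<le> G R) \<Longrightarrow> avg n F \<le> avg n G"
  unfolding avg_def by (intro divide_right_mono sum_mono) auto

lemma avg_cong: "(\<And>R. R \<in> even_subsets n \<Longrightarrow> F R = G R) \<Longrightarrow> avg n F = avg n G"
  unfolding avg_def by (simp cong: sum.cong)

lemma avg_add: "avg n (\<lambda>R. F R + G R) = avg n F + avg n G"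
  by (simp add: avg_def sum.distrib add_divide_distrib)

lemma avg_diff: "avg n (\<lambda>R. F R - G R) = avg n F - avg n G"
  by (simp add: avg_def sum_subtractf diff_divide_distrib)

lemma avg_cmult: "avg n (\<lambda>R. c * F R) = c * avg n F"
  by (simp add: avg_def sum_distrib_left)

lemma avg_sum: "avg n (\<lambda>R. \<Sum>x\<in>A. F x R) = (\<Sum>x\<in>A. avg n (F x))"
  unfolding avg_def sum_divide_distrib[symmetric] by (subst sum.swap) simp

lemma avg_nonneg: "(\<And>R. R \<in> even_subsets n \<Longrightarrow> 0 \<le> F R) \<Longrightarrow> 0 \<le> avg n F"
  unfolding avg_def by (intro divide_nonneg_nonneg sum_nonneg) auto

lemma avg_abs: "\<bar>avg n F\<bar> \<le> avg n (\<lambda>R. \<bar>F R\<bar>)"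
  unfolding avg_def by (simp add: divide_right_mono sum_abs)

text \<open>The point \<open>x\<close> that repairs the parity is arbitrary: the last point
  describes \<open>CP\<close>, and a point outside a window makes the window colours free.\<close>

lemma bij_betw_even_subsets:
  assumes "x \<in> {1..2*n}"
  shows "bij_betw (\<lambda>T. if even (card T) then T else insert x T) (Pow ({1..2*n} - {x})) (even_subsets n)"
proof (rule bij_betw_byWitness[where f' = "\<lambda>R. R - {x}"])
  show "\<forall>T\<in>Pow ({1..2*n} - {x}). (if even (card T) then T else insert x T) - {x} = T" by auto
  show "\<forall>R\<in>even_subsets n. (if even (card (R - {x})) then R - {x} else insert x (R - {x})) = R"
  proof
    fix R assume R: "R \<in> even_subsets n"
    show "(if even (card (R - {x})) then R - {x} else insert x (R - {x})) = R"
    proof (cases "x \<in> R")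
      case True
      have "card R = Suc (card (R - {x}))" using True even_subsets_finite[OF R] by (simp only: card.remove)
      then show ?thesis using True R unfolding even_subsets_def by auto
    next
      case False
      then show ?thesis using R unfolding even_subsets_def by simp
    qed
  qed
  show "(\<lambda>T. if even (card T) then T else insert x T) ` Pow ({1..2*n} - {x}) \<subseteq> even_subsets n"
  proof (rule image_subsetI)
    fix T assume T: "T \<in> Pow ({1..2*n} - {x})"
    then have "finite T" "x \<notin> T" "T \<subseteq> {1..2*n}" by (auto intro: finite_subset)
    then show "(if even (card T) then T else insert x T) \<in> even_subsets n"
      using assms unfolding even_subsets_def by auto
  qed
  show "(\<lambda>R. R - {x}) ` even_subsets n \<subseteq> Pow ({1..2*n} - {x})"
    unfolding even_subsets_def by auto
qed

text \<open>The parity constraint is invisible on a proper subset of the points.\<close>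
lemma avg_local:
  assumes U: "U \<subseteq> {1..2*n}" "card U < 2 * n"
  shows "avg n (\<lambda>R. \<phi> (R \<inter> U)) = (\<Sum>P\<in>Pow U. \<phi> P) / 2 ^ card U"
proof -
  have finU: "finite U" using U(1) by (rule finite_subset) simp
  \<comment> \<open>This point absorbs the parity constraint, so the colours on \<open>U\<close> are
    unconstrained.\<close>
  obtain x where x: "x \<in> {1..2*n}" "x \<notin> U"
    using U by (metis card_atLeastAtMost diff_Suc_1 less_irrefl subsetI subset_antisym)
  let ?Z = "{1..2*n} - {x} - U"
  have cZ: "card ?Z = 2 * n - 1 - card U"
    using x U finU by (subst card_Diff_subset) auto
  have "(\<Sum>R\<in>even_subsets n. \<phi> (R \<inter> U)) =
      (\<Sum>T\<in>Pow ({1..2*n} - {x}). \<phi> ((if even (card T) then T else insert x T) \<inter> U))"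
    by (rule sum.reindex_bij_betw[OF bij_betw_even_subsets[OF x(1)], symmetric])
  also have "\<dots> = (\<Sum>T\<in>Pow ({1..2*n} - {x}). \<phi> (T \<inter> U))"
    by (rule sum.cong) (use x in auto)
  also have "\<dots> = (\<Sum>(P, Q)\<in>Pow U \<times> Pow ?Z. \<phi> P)"
  proof (rule sum.reindex_bij_witness[of _ "\<lambda>(P, Q). P \<union> Q" "\<lambda>T. (T \<inter> U, T - U)"], goal_cases)
    case (1 T)
    then show ?case by auto
  next
    case (2 T)
    then show ?case by auto
  next
    case (3 p)
    then show ?case by (cases p) auto
  next
    case (4 p)
    then show ?case using x U by (cases p) auto
  next
    case (5 T)
    then show ?case by auto
  qed
  also have "\<dots> = 2 ^ (2 * n - 1 - card U) * (\<Sum>P\<in>Pow U. \<phi> P)"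
    by (simp only: sum.cartesian_product[symmetric] sum_constant card_Pow finite_Diff finite_atLeastAtMost cZ
        sum_distrib_left of_nat_power of_nat_numeral)
  finally have "avg n (\<lambda>R. \<phi> (R \<inter> U)) = 2 ^ (2 * n - 1 - card U) * (\<Sum>P\<in>Pow U. \<phi> P) / 2 ^ (2 * n - 1)"
    by (simp add: avg_def)
  also have "(2::real) ^ (2 * n - 1) = 2 ^ (2 * n - 1 - card U) * 2 ^ card U"
    using U(2) by (simp add: power_add[symmetric])
  finally show ?thesis by simp
qed

lemma avg_const: "n \<ge> 1 \<Longrightarrow> avg n (\<lambda>_. c) = c"
  using avg_local[of "{}" n "\<lambda>_. c"] by simp

section \<open>Catalan ratios and their averaged deviation from the limit\<close>

text \<open>When a > k, truncated subtraction leaves the numerator \<open>catalan 0\<close>, so the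
  bounds 0 and 1 hold for all arguments.\<close>

definition rho :: "nat \<Rightarrow> nat \<Rightarrow> real" where
  "rho a k = catalan (k - a) / catalan k"

lemma rho_nonneg: "0 \<le> rho a k" and rho_le_1: "rho a k \<le> 1"
  using catalan_pos[of k] catalan_pos[of "k - a"] catalan_mono[of "k - a" k]
  by (simp_all add: rho_def)

text \<open>\<open>rho (Suc a) k\<close> is \<open>rho 1 (k - a)\<close> times
  \<open>rho a k\<close>, and the one-step ratio tends to 1/4 by the two-term recursion.\<close>

lemma rho_tendsto: "(\<lambda>k. rho a k) \<longlonglongrightarrow> (1/4) ^ a"
proof (induction a)
  case 0
  have "rho 0 k = 1" for k using catalan_pos[of k] by (simp add: rho_def)
  then show ?case by simp
next
  case (Suc a)
  have "(\<lambda>k. rho 1 (Suc k)) \<longlonglongrightarrow> 1/4"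
  proof -
    have "rho 1 (Suc k) = real (k + 2) / real (4 * k + 2)" for k
      using catalan_pos[of k] by (simp add: rho_def catalan_Suc_eq)
    moreover have "(\<lambda>k::nat. real (k + 2) / real (4 * k + 2)) \<longlonglongrightarrow> 1/4" by real_asymp
    ultimately show ?thesis by simp
  qed
  then have "(\<lambda>k. rho 1 k) \<longlonglongrightarrow> 1/4" by (simp add: filterlim_sequentially_Suc)
  moreover have "filterlim (\<lambda>k. k - a) at_top sequentially"
    by (rule filterlim_minus_const_nat_at_top)
  ultimately have "(\<lambda>k. rho 1 (k - a)) \<longlonglongrightarrow> 1/4" by (rule filterlim_compose)
  then have "(\<lambda>k. rho 1 (k - a) * rho a k) \<longlonglongrightarrow> 1/4 * (1/4) ^ a" by (rule tendsto_mult[OF _ Suc])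
  moreover have "rho 1 (k - a) * rho a k = rho (Suc a) k" for k
    using catalan_pos[of "k - a"] by (simp add: rho_def)
  ultimately show ?case by simp
qed

lemma binomial_over_pow2_tendsto: "(\<lambda>n. real (n choose r) / 2 ^ n) \<longlonglongrightarrow> 0"
proof (rule Lim_null_comparison)
  show "(\<lambda>n. real n ^ r / 2 ^ n) \<longlonglongrightarrow> 0" by real_asymp
  have "n choose r \<le> n ^ r" for n
    using binomial_le_pow[of r n] by (cases "r \<le> n") (auto simp: not_le binomial_eq_0)
  then have "real (n choose r) \<le> real n ^ r" for n by (metis of_nat_le_iff of_nat_power)
  then show "eventually (\<lambda>n. norm (real (n choose r) / 2 ^ n) \<le> real n ^ r / 2 ^ n) sequentially"
    by (simp add: divide_right_mono)
qed

text \<open>Colourings with fewer than 2K red points are polynomially many among exponentially many;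
  on all others \<phi> is small.\<close>

lemma avg_half_card_tendsto_0:
  fixes \<phi> :: "nat \<Rightarrow> real"
  assumes bd: "\<And>k. \<bar>\<phi> k\<bar> \<le> 1" and lim: "\<phi> \<longlonglongrightarrow> 0"
  shows "(\<lambda>n. avg n (\<lambda>R. \<bar>\<phi> (card R div 2)\<bar>)) \<longlonglongrightarrow> 0"
proof (rule LIMSEQ_I)
  fix \<epsilon> :: real assume \<epsilon>: "0 < \<epsilon>"
  then obtain K where K: "\<And>k. k \<ge> K \<Longrightarrow> \<bar>\<phi> k\<bar> < \<epsilon> / 2"
    using LIMSEQ_D[OF lim, of "\<epsilon> / 2"] by auto
  have "(\<lambda>n. \<Sum>r<2*K. real ((2*n) choose r) / 2 ^ (2*n)) \<longlonglongrightarrow> 0"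
    by (intro tendsto_null_sum filterlim_compose[OF binomial_over_pow2_tendsto]) real_asymp
  \<comment> \<open>The factor 2 compensates for averaging over the 2^(2n-1) even subsets instead of
    all 2^(2n) subsets.\<close>
  then have "(\<lambda>n. 2 * (\<Sum>r<2*K. real ((2*n) choose r) / 2 ^ (2*n))) \<longlonglongrightarrow> 2 * 0"
    by (intro tendsto_mult tendsto_const)
  from LIMSEQ_D[OF this, of "\<epsilon> / 2"] \<epsilon> obtain N where
    N: "\<And>n. n \<ge> N \<Longrightarrow> \<bar>2 * (\<Sum>r<2*K. real ((2*n) choose r) / 2 ^ (2*n))\<bar> < \<epsilon> / 2"
    by (simp only: mult_zero_right diff_zero real_norm_def half_gt_zero) blast
  have "norm (avg n (\<lambda>R. \<bar>\<phi> (card R div 2)\<bar>) - 0) < \<epsilon>" if n: "n \<ge> max 1 N" for n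
  proof -
    let ?B = "{R \<in> even_subsets n. card R < 2 * K}"
    have n1: "n \<ge> 1" using n by simp
    have "avg n (\<lambda>R. \<bar>\<phi> (card R div 2)\<bar>) \<le> avg n (\<lambda>R. \<epsilon> / 2 + of_bool (card R < 2 * K))"
    proof (rule avg_mono)
      fix R
      show "\<bar>\<phi> (card R div 2)\<bar> \<le> \<epsilon> / 2 + of_bool (card R < 2 * K)"
      proof (cases "card R < 2 * K")
        case True
        then show ?thesis using bd[of "card R div 2"] \<epsilon> by simp
      next
        case False
        then have "K \<le> card R div 2" by linarith
        then show ?thesis using K[of "card R div 2"] False by simp
      qed
    qed
    also have "\<dots> = \<epsilon> / 2 + avg n (\<lambda>R. of_bool (card R < 2 * K))"
      by (simp only: avg_add avg_const[OF n1])
    also have "avg n (\<lambda>R. of_bool (card R < 2 * K)) = real (card ?B) / 2 ^ (2 * n - 1)"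
      by (simp add: avg_def finite_even_subsets Int_def conj_commute)
    also have "card ?B \<le> card (\<Union>r<2*K. {R. R \<subseteq> {1..2*n} \<and> card R = r})"
      by (rule card_mono) (auto simp: even_subsets_def intro!: finite_subset[of _ "Pow {1..2*n}"])
    then have "real (card ?B) / 2 ^ (2 * n - 1) \<le> real (\<Sum>r<2*K. (2*n) choose r) / 2 ^ (2 * n - 1)"
      using card_UN_le[of "{..<2*K}" "\<lambda>r. {R. R \<subseteq> {1..2*n} \<and> card R = r}"] n_subsets[of "{1..2*n}"]
      by (intro divide_right_mono of_nat_mono) auto
    also have "\<dots> = 2 * (\<Sum>r<2*K. real ((2*n) choose r) / 2 ^ (2*n))"
    proof -
      have "(2::real) ^ (2 * n) = 2 * 2 ^ (2 * n - 1)" using n1 by (simp flip: power_Suc)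
      then show ?thesis by (simp add: sum_divide_distrib[symmetric])
    qed
    also have "\<dots> < \<epsilon> / 2" using N[of n] n by auto
    finally have "avg n (\<lambda>R. \<bar>\<phi> (card R div 2)\<bar>) < \<epsilon>" by simp
    moreover have "0 \<le> avg n (\<lambda>R. \<bar>\<phi> (card R div 2)\<bar>)" by (rule avg_nonneg) simp
    ultimately show ?thesis by simp
  qed
  then show "\<exists>no. \<forall>n\<ge>no. norm (avg n (\<lambda>R. \<bar>\<phi> (card R div 2)\<bar>) - 0) < \<epsilon>" by blast
qed

definition ratio_dev :: "nat \<Rightarrow> nat \<Rightarrow> nat \<Rightarrow> real" where
  "ratio_dev n a b = avg n (\<lambda>R. \<bar>rho a (card R div 2) * rho b (n - card R div 2) - (1/4) ^ (a + b)\<bar>)"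

text \<open>The number of red and blue points in a window varies with the colouring; summing over
  all pairs up to \<open>u\<close> gives one bound for every colouring and every position.\<close>

definition err :: "nat \<Rightarrow> nat \<Rightarrow> real" where
  "err u n = (\<Sum>a\<le>u. \<Sum>b\<le>u. ratio_dev n a b)"

lemma ratio_dev_nonneg: "0 \<le> ratio_dev n a b"
  unfolding ratio_dev_def by (rule avg_nonneg) simp

lemma err_nonneg: "0 \<le> err u n"
  unfolding err_def by (intro sum_nonneg ratio_dev_nonneg)

text \<open>The error of the product is at most the sum of the two errors, as all factors lie in
  [0,1]; the blue error becomes a red one by \<open>avg_complement\<close>.\<close>

lemma ratio_dev_tendsto: "(\<lambda>n. ratio_dev n a b) \<longlonglongrightarrow> 0"
proof -
  have pw: "(1/4::real) ^ c \<le> 1" for c by (simp add: power_le_one)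
  have L: "(\<lambda>n. avg n (\<lambda>R. \<bar>rho c (card R div 2) - (1/4) ^ c\<bar>)) \<longlonglongrightarrow> 0" for c
  proof (rule avg_half_card_tendsto_0)
    fix k
    show "\<bar>rho c k - (1/4) ^ c\<bar> \<le> 1"
      using rho_nonneg[of c k] rho_le_1[of c k] pw[of c] zero_le_power[of "1/4::real" c] by linarith
    show "(\<lambda>k. rho c k - (1/4) ^ c) \<longlonglongrightarrow> 0"
      using rho_tendsto[of c] by (simp add: LIM_zero)
  qed
  have le: "ratio_dev n a b \<le> avg n (\<lambda>R. \<bar>rho a (card R div 2) - (1/4) ^ a\<bar>) +
      avg n (\<lambda>R. \<bar>rho b (card R div 2) - (1/4) ^ b\<bar>)" for n
  proof -
    have "ratio_dev n a b \<le> avg n (\<lambda>R. \<bar>rho a (card R div 2) - (1/4) ^ a\<bar> +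
        \<bar>rho b (card ({1..2*n} - R) div 2) - (1/4) ^ b\<bar>)"
      unfolding ratio_dev_def
    proof (rule avg_mono)
      fix R assume R: "R \<in> even_subsets n"
      let ?x = "rho a (card R div 2)" and ?y = "rho b (n - card R div 2)"
      have "?x * ?y - (1/4) ^ (a + b) = (?x - (1/4) ^ a) * ?y + (1/4) ^ a * (?y - (1/4) ^ b)"
        by (simp add: algebra_simps power_add)
      also have "\<bar>\<dots>\<bar> \<le> \<bar>?x - (1/4) ^ a\<bar> * \<bar>?y\<bar> + \<bar>(1/4) ^ a\<bar> * \<bar>?y - (1/4) ^ b\<bar>"
        by (simp only: abs_mult[symmetric] abs_triangle_ineq)
      also have "\<dots> \<le> \<bar>?x - (1/4) ^ a\<bar> * 1 + 1 * \<bar>?y - (1/4) ^ b\<bar>"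
        using rho_nonneg[of b] rho_le_1[of b] pw[of a]
        by (intro add_mono mult_left_mono mult_right_mono) auto
      finally show "\<bar>?x * ?y - (1/4) ^ (a + b)\<bar> \<le> \<bar>?x - (1/4) ^ a\<bar> +
          \<bar>rho b (card ({1..2*n} - R) div 2) - (1/4) ^ b\<bar>"
        using card_complement_even_subset(2)[OF R] by simp
    qed
    then show ?thesis
      unfolding avg_add avg_complement[of n "\<lambda>R. \<bar>rho b (card R div 2) - (1/4) ^ b\<bar>"] .
  qed
  show ?thesis
  proof (rule Lim_null_comparison)
    show "(\<lambda>n. avg n (\<lambda>R. \<bar>rho a (card R div 2) - (1/4) ^ a\<bar>) +
      avg n (\<lambda>R. \<bar>rho b (card R div 2) - (1/4) ^ b\<bar>)) \<longlonglongrightarrow> 0"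
      using tendsto_add[OF L[of a] L[of b]] by simp
  qed (use le ratio_dev_nonneg in simp)
qed

lemma err_tendsto: "err u \<longlonglongrightarrow> 0"
  unfolding err_def[abs_def] by (intro tendsto_null_sum ratio_dev_tendsto)

text \<open>With the ratios replaced by their limits, only the colours in \<open>U\<close> matter
  and \<open>avg_local\<close> evaluates the average exactly. The cost of the replacement does not
  involve the position of \<open>U\<close>.\<close>

lemma avg_window:
  assumes U: "U \<subseteq> {1..2*n}" "card U < 2 * n"
    and h: "\<And>P. P \<subseteq> U \<Longrightarrow> 0 \<le> h P \<and> h P \<le> H"
    and ab: "\<And>P. P \<subseteq> U \<Longrightarrow> \<alpha> P \<le> u \<and> \<beta> P \<le> u"
  shows "\<bar>avg n (\<lambda>R. h (R \<inter> U) * (rho (\<alpha> (R \<inter> U)) (card R div 2) * rho (\<beta> (R \<inter> U)) (n - card R div 2)))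
    - (\<Sum>P\<in>Pow U. h P * (1/4) ^ (\<alpha> P + \<beta> P)) / 2 ^ card U\<bar> \<le> H * err u n"
proof -
  let ?d = "\<lambda>a b R. \<bar>rho a (card R div 2) * rho b (n - card R div 2) - (1/4) ^ (a + b)\<bar>"
  have H: "0 \<le> H" using h[of "{}"] by simp
  have eq: "avg n (\<lambda>R. h (R \<inter> U) * (rho (\<alpha> (R \<inter> U)) (card R div 2) * rho (\<beta> (R \<inter> U)) (n - card R div 2)))
      - (\<Sum>P\<in>Pow U. h P * (1/4) ^ (\<alpha> P + \<beta> P)) / 2 ^ card U =
    avg n (\<lambda>R. h (R \<inter> U) * (rho (\<alpha> (R \<inter> U)) (card R div 2) * rho (\<beta> (R \<inter> U)) (n - card R div 2)
       - (1/4) ^ (\<alpha> (R \<inter> U) + \<beta> (R \<inter> U))))"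
    by (simp only: avg_local[OF U, of "\<lambda>P. h P * (1/4) ^ (\<alpha> P + \<beta> P)", symmetric] right_diff_distrib avg_diff)
  have "avg n (\<lambda>R. \<bar>h (R \<inter> U) * (rho (\<alpha> (R \<inter> U)) (card R div 2) * rho (\<beta> (R \<inter> U)) (n - card R div 2)
       - (1/4) ^ (\<alpha> (R \<inter> U) + \<beta> (R \<inter> U)))\<bar>) \<le> avg n (\<lambda>R. H * (\<Sum>a\<le>u. \<Sum>b\<le>u. ?d a b R))"
  proof (rule avg_mono)
    fix R
    let ?a = "\<alpha> (R \<inter> U)" and ?b = "\<beta> (R \<inter> U)"
    have ab': "?a \<le> u" "?b \<le> u" and h': "0 \<le> h (R \<inter> U)" "h (R \<inter> U) \<le> H"
      using ab[OF Int_lower2] h[OF Int_lower2] by simp_all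
    have "?d ?a ?b R \<le> (\<Sum>b\<le>u. ?d ?a b R)"
      by (rule member_le_sum[where f = "\<lambda>b. ?d ?a b R"]) (simp_all add: ab')
    also have "\<dots> \<le> (\<Sum>a\<le>u. \<Sum>b\<le>u. ?d a b R)"
      by (rule member_le_sum[where f = "\<lambda>a. \<Sum>b\<le>u. ?d a b R"]) (simp_all add: ab' sum_nonneg)
    finally have "h (R \<inter> U) * ?d ?a ?b R \<le> H * (\<Sum>a\<le>u. \<Sum>b\<le>u. ?d a b R)"
      by (intro mult_mono h' H) simp_all
    then show "\<bar>h (R \<inter> U) * (rho ?a (card R div 2) * rho ?b (n - card R div 2) - (1/4) ^ (?a + ?b))\<bar>
        \<le> H * (\<Sum>a\<le>u. \<Sum>b\<le>u. ?d a b R)"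
      using h' by (simp add: abs_mult)
  qed
  also have "\<dots> = H * err u n"
    by (simp add: avg_cmult avg_sum err_def ratio_dev_def)
  finally show ?thesis unfolding eq by (rule order_trans[OF avg_abs])
qed

section \<open>The law of the Catalan-pair graph\<close>

lemma n_matchings_pos:
  assumes "R \<in> even_subsets n"
  shows "n_matchings R > 0" "n_matchings ({1..2*n} - R) > 0"
proof -
  have *: "n_matchings R > 0" if "R \<in> even_subsets n" for R
    using that even_subsets_finite[OF that] catalan_pos by (simp add: n_matchings_eq even_subsets_def)
  show "n_matchings R > 0" "n_matchings ({1..2*n} - R) > 0"
    using *[OF assms] *[OF card_complement_even_subset(1)[OF assms]] .
qed

definition CP_given :: "nat \<Rightarrow> nat set \<Rightarrow> nat set set pmf" where
  "CP_given n R = bind_pmf (pmf_of_set (catalan_matchings R)) (\<lambda>MR.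
     bind_pmf (pmf_of_set (catalan_matchings ({1..2*n} - R))) (\<lambda>MB. return_pmf (MR \<union> MB)))"

lemma CP_given_nonempty_finite:
  assumes "R \<in> even_subsets n"
  shows "catalan_matchings R \<noteq> {}" "catalan_matchings ({1..2*n} - R) \<noteq> {}"
    "finite (catalan_matchings R)" "finite (catalan_matchings ({1..2*n} - R))"
  using n_matchings_pos[OF assms] even_subsets_finite[OF assms]
  by (auto simp: n_matchings_def finite_catalan_matchings)

lemma set_pmf_CP_given:
  assumes "R \<in> even_subsets n"
  shows "set_pmf (CP_given n R) = (\<lambda>p. fst p \<union> snd p) ` matching_pairs R ({1..2*n} - R)"
proof -
  have "set_pmf (CP_given n R) = (\<Union>MR\<in>catalan_matchings R. \<Union>MB\<in>catalan_matchings ({1..2*n} - R). {MR \<union> MB})"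
    using CP_given_nonempty_finite[OF assms] unfolding CP_given_def by simp
  also have "\<dots> = (\<lambda>p. fst p \<union> snd p) ` matching_pairs R ({1..2*n} - R)"
    unfolding matching_pairs_def by (auto simp: image_def Bex_def)
  finally show ?thesis .
qed

lemma finite_set_pmf_CP_given:
  "R \<in> even_subsets n \<Longrightarrow> finite (set_pmf (CP_given n R))"
  by (simp add: set_pmf_CP_given finite_matching_pairs even_subsets_finite)

text \<open>Colouring all points but the last freely and then repairing the parity is a bijection
  onto the even subsets, so the red set is uniform on them.\<close>

lemma CP_eq:
  assumes "n \<ge> 1"
  shows "CP n = bind_pmf (pmf_of_set (even_subsets n)) (CP_given n)"
proof -
  let ?c = "\<lambda>T. if even (card T) then T else insert (2*n) T"
  have bij: "bij_betw ?c (Pow ({1..2*n} - {2*n})) (even_subsets n)"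
    by (rule bij_betw_even_subsets) (use assms in simp)
  have e: "{1..2*n} - {2*n} = {1..2*n-1}" using assms by auto
  have "pmf_of_set (even_subsets n) = map_pmf ?c (pmf_of_set (Pow {1..2*n-1}))"
    using bij unfolding e by (intro map_pmf_of_set_bij_betw[symmetric]) auto
  then show ?thesis unfolding CP_def Let_def CP_given_def by (simp add: bind_map_pmf)
qed

lemma even_subsets_nonempty: "even_subsets n \<noteq> {}"
proof -
  have "{} \<in> even_subsets n" by (simp add: even_subsets_def)
  then show ?thesis by blast
qed

lemma card_even_subsets: "n \<ge> 1 \<Longrightarrow> real (card (even_subsets n)) = 2 ^ (2*n - 1)"
  using avg_const[of n 1] by (simp add: avg_def field_simps)

lemma set_pmf_CP:
  "n \<ge> 1 \<Longrightarrow> set_pmf (CP n) = (\<Union>R\<in>even_subsets n. (\<lambda>p. fst p \<union> snd p) ` matching_pairs R ({1..2*n} - R))"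
  by (simp add: CP_eq set_pmf_CP_given even_subsets_nonempty finite_even_subsets)

lemma finite_set_pmf_CP: "n \<ge> 1 \<Longrightarrow> finite (set_pmf (CP n))"
  by (auto simp: set_pmf_CP finite_even_subsets intro!: finite_matching_pairs intro: even_subsets_finite)

lemma expectation_CP_given:
  fixes f :: "nat set set \<Rightarrow> real"
  assumes R: "R \<in> even_subsets n"
  shows "measure_pmf.expectation (CP_given n R) f =
    (\<Sum>p\<in>matching_pairs R ({1..2*n} - R). f (fst p \<union> snd p)) / (n_matchings R * n_matchings ({1..2*n} - R))"
proof -
  note ne = CP_given_nonempty_finite[OF R]
  have "measure_pmf.expectation (CP_given n R) f =
    (\<Sum>MR\<in>catalan_matchings R. (\<Sum>MB\<in>catalan_matchings ({1..2*n} - R). f (MR \<union> MB) / n_matchings ({1..2*n} - R)) / n_matchings R)"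
    unfolding CP_given_def n_matchings_def
    by (subst pmf_expectation_bind_pmf_of_set; (subst pmf_expectation_bind_pmf_of_set)?) (use ne in \<open>simp_all add: divide_inverse_commute\<close>)
  then show ?thesis
    by (simp add: matching_pairs_def sum.cartesian_product' sum_divide_distrib mult.commute)
qed

lemma expectation_CP:
  fixes f :: "nat set set \<Rightarrow> real"
  assumes "n \<ge> 1"
  shows "measure_pmf.expectation (CP n) f =
    avg n (\<lambda>R. (\<Sum>p\<in>matching_pairs R ({1..2*n} - R). f (fst p \<union> snd p)) / (n_matchings R * n_matchings ({1..2*n} - R)))"
proof -
  have "measure_pmf.expectation (CP n) f = (\<Sum>R\<in>even_subsets n. measure_pmf.expectation (CP_given n R) f / real (card (even_subsets n)))"
    unfolding CP_eq[OF assms]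
    by (subst pmf_expectation_bind_pmf_of_set) (simp_all add: even_subsets_nonempty finite_even_subsets finite_set_pmf_CP_given divide_inverse mult.commute)
  also have "\<dots> = avg n (\<lambda>R. measure_pmf.expectation (CP_given n R) f)"
    by (simp add: card_even_subsets[OF assms] avg_def sum_divide_distrib)
  also have "\<dots> = avg n (\<lambda>R. (\<Sum>p\<in>matching_pairs R ({1..2*n} - R). f (fst p \<union> snd p)) / (n_matchings R * n_matchings ({1..2*n} - R)))"
    by (rule avg_cong) (simp add: expectation_CP_given)
  finally show ?thesis .
qed

lemma expectation_CP_of_bool:
  assumes "n \<ge> 1"
  shows "measure_pmf.expectation (CP n) (\<lambda>M. of_bool (Q M)) =
    avg n (\<lambda>R. real (card {p \<in> matching_pairs R ({1..2*n} - R). Q (fst p \<union> snd p)}) / (n_matchings R * n_matchings ({1..2*n} - R)))"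
  unfolding expectation_CP[OF assms]
proof (rule avg_cong)
  fix R assume "R \<in> even_subsets n"
  then have "finite (matching_pairs R ({1..2*n} - R))"
    by (intro finite_matching_pairs) (auto intro: even_subsets_finite)
  then show "(\<Sum>p\<in>matching_pairs R ({1..2*n} - R). of_bool (Q (fst p \<union> snd p))) / (n_matchings R * n_matchings ({1..2*n} - R)) =
    real (card {p \<in> matching_pairs R ({1..2*n} - R). Q (fst p \<union> snd p)}) / (n_matchings R * n_matchings ({1..2*n} - R))"
    by (simp add: sum_of_bool_eq Int_def)
qed

text \<open>Evenness of both cardinalities makes halving commute with the subtraction.\<close>

lemma n_matchings_Diff_ratio:
  assumes "finite S" "even (card S)" "even (card (S \<inter> U))"
  shows "n_matchings (S - U) / n_matchings S = rho (card (S \<inter> U) div 2) (card S div 2)"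
proof -
  have c: "card (S - U) = card S - card (S \<inter> U)" using assms(1) by (simp add: card_Diff_subset_Int)
  have "card (S \<inter> U) \<le> card S" using assms(1) by (simp add: card_mono)
  then have "even (card (S - U))" "card (S - U) div 2 = card S div 2 - card (S \<inter> U) div 2"
    using c assms(2,3) by auto
  then show ?thesis using assms by (simp add: n_matchings_eq rho_def)
qed

lemma n_matchings_ratio:
  assumes R: "R \<in> even_subsets n" and U: "U \<subseteq> {1..2*n}" "even (card (R \<inter> U))" "even (card (U - R \<inter> U))"
  shows "n_matchings (R - U) * n_matchings ({1..2*n} - R - U) / (n_matchings R * n_matchings ({1..2*n} - R)) =
    rho (card (R \<inter> U) div 2) (card R div 2) * rho (card (U - R \<inter> U) div 2) (n - card R div 2)"
proof -
  have B: "({1..2*n} - R) \<inter> U = U - R \<inter> U" using U by blast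
  note c = card_complement_even_subset[OF R]
  have "n_matchings (R - U) / n_matchings R = rho (card (R \<inter> U) div 2) (card R div 2)"
    by (rule n_matchings_Diff_ratio) (use R U even_subsets_finite[OF R] in \<open>auto simp: even_subsets_def\<close>)
  moreover have "n_matchings ({1..2*n} - R - U) / n_matchings ({1..2*n} - R) = rho (card (U - R \<inter> U) div 2) (n - card R div 2)"
    using n_matchings_Diff_ratio[of "{1..2*n} - R" U] c(1,2) U(3) unfolding B by (simp add: even_subsets_def)
  ultimately show ?thesis by (metis times_divide_times_eq)
qed

text \<open>Covers one window and a union of two alike: \<open>cnt\<close> is the factorisation of
  the count, and \<open>ev\<close> makes the Catalan ratios applicable wherever the weight is
  nonzero.\<close>

lemma expectation_window:
  assumes n: "n \<ge> 1" and U: "U \<subseteq> {1..2*n}" "card U < 2 * n"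
    and cnt: "\<And>R. real (card {p \<in> matching_pairs R ({1..2*n} - R). Q (fst p \<union> snd p)}) =
      h (R \<inter> U) * (n_matchings (R - U) * n_matchings ({1..2*n} - R - U))"
    and h: "\<And>P. P \<subseteq> U \<Longrightarrow> 0 \<le> h P \<and> h P \<le> H"
    and ev: "\<And>P. P \<subseteq> U \<Longrightarrow> h P \<noteq> 0 \<Longrightarrow> even (card P) \<and> even (card (U - P))"
  shows "\<bar>measure_pmf.expectation (CP n) (\<lambda>M. of_bool (Q M)) - (\<Sum>P\<in>Pow U. h P) / 4 ^ card U\<bar> \<le> H * err (card U) n"
proof -
  have finU: "finite U" using U(1) by (rule finite_subset) simp
  let ?\<alpha> = "\<lambda>P. card P div 2" and ?\<beta> = "\<lambda>P. card (U - P) div 2"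
  have 1: "measure_pmf.expectation (CP n) (\<lambda>M. of_bool (Q M)) =
    avg n (\<lambda>R. h (R \<inter> U) * (rho (?\<alpha> (R \<inter> U)) (card R div 2) * rho (?\<beta> (R \<inter> U)) (n - card R div 2)))"
    unfolding expectation_CP_of_bool[OF n] cnt
  proof (rule avg_cong)
    fix R assume R: "R \<in> even_subsets n"
    show "h (R \<inter> U) * (n_matchings (R - U) * n_matchings ({1..2*n} - R - U)) / (n_matchings R * n_matchings ({1..2*n} - R)) =
      h (R \<inter> U) * (rho (?\<alpha> (R \<inter> U)) (card R div 2) * rho (?\<beta> (R \<inter> U)) (n - card R div 2))"
    proof (cases "h (R \<inter> U) = 0")
      case False
      then have "even (card (R \<inter> U))" "even (card (U - R \<inter> U))" using ev[OF Int_lower2] by simp_all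
      from n_matchings_ratio[OF R U(1) this] show ?thesis by (simp only: times_divide_eq_right[symmetric])
    qed simp
  qed
  \<comment> \<open>The exponents add up to half of \<open>card U\<close>, so the ratios contribute
    2^(-card U) for every colouring; with the colouring probability this makes 4^(-card U).\<close>
  have 2: "(\<Sum>P\<in>Pow U. h P * (1/4) ^ (?\<alpha> P + ?\<beta> P)) / 2 ^ card U = (\<Sum>P\<in>Pow U. h P) / 4 ^ card U"
  proof -
    have "h P * (1/4) ^ (?\<alpha> P + ?\<beta> P) = h P / 2 ^ card U" if P: "P \<in> Pow U" for P
    proof (cases "h P = 0")
      case False
      then have e: "even (card P)" "even (card (U - P))" using ev P by auto
      have "card U = card P + card (U - P)"
        using P finU by (metis Pow_iff card_Un_disjoint Diff_disjoint Un_Diff_cancel Un_absorb1 finite_Diff finite_subset)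
      then have U2: "card U = 2 * (?\<alpha> P + ?\<beta> P)" using e by auto
      have "(2::real) ^ card U = 4 ^ (?\<alpha> P + ?\<beta> P)" unfolding U2 power_mult by simp
      then show ?thesis by (simp add: power_divide)
    qed simp
    then have "(\<Sum>P\<in>Pow U. h P * (1/4) ^ (?\<alpha> P + ?\<beta> P)) = (\<Sum>P\<in>Pow U. h P) / 2 ^ card U"
      by (simp add: sum_divide_distrib)
    moreover have "(4::real) ^ card U = 2 ^ card U * 2 ^ card U" by (simp flip: power_mult_distrib)
    ultimately show ?thesis by simp
  qed
  have 3: "card P div 2 \<le> card U \<and> card (U - P) div 2 \<le> card U" if "P \<subseteq> U" for P
    using card_mono[OF finU that] card_mono[OF finU Diff_subset[of U P]] by linarith
  have "\<bar>avg n (\<lambda>R. h (R \<inter> U) * (rho (?\<alpha> (R \<inter> U)) (card R div 2) * rho (?\<beta> (R \<inter> U)) (n - card R div 2)))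
    - (\<Sum>P\<in>Pow U. h P * (1/4) ^ (?\<alpha> P + ?\<beta> P)) / 2 ^ card U\<bar> \<le> H * err (card U) n"
    by (rule avg_window[OF U, of h H ?\<alpha> "card U" ?\<beta>]) (simp_all only: h 3)
  then show ?thesis unfolding 1 2 .
qed

section \<open>Local densities of arcs and isolated arcs\<close>

lemma sum_Pow_card:
  assumes "finite A"
  shows "(\<Sum>P\<in>Pow A. \<phi> (card P)) = (\<Sum>c\<le>card A. real (card A choose c) * \<phi> c)"
proof -
  have "(\<Sum>P\<in>Pow A. \<phi> (card P)) = (\<Sum>c\<le>card A. \<Sum>P\<in>{P \<in> Pow A. card P = c}. \<phi> (card P))"
    using assms by (intro sum.group[symmetric]) (auto intro: card_mono)
  also have "\<dots> = (\<Sum>c\<le>card A. real (card A choose c) * \<phi> c)"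
    using n_subsets[OF assms] by (intro sum.cong) auto
  finally show ?thesis .
qed

text \<open>The value 0 at odd sizes lets sums run over all colour splittings.\<close>

definition mcount :: "nat \<Rightarrow> real" where
  "mcount c = (if even c then catalan (c div 2) else 0)"

lemma n_matchings_mcount: "finite S \<Longrightarrow> n_matchings S = mcount (card S)"
  by (simp add: n_matchings_eq mcount_def)

lemma mcount_nonneg: "0 \<le> mcount c"
  by (simp add: mcount_def less_imp_le[OF catalan_pos])

text \<open>The index \<open>N\<close> is the number of points strictly between the endpoints of the arc.\<close>
definition iso_density :: "nat \<Rightarrow> real" where
  "iso_density N = 2 * (\<Sum>c\<le>N. real (N choose c) * (mcount c * mcount (N - c))) / 4 ^ (N + 2)"

text \<open>Only the colour of the arc matters: \<open>c\<close> points of that colour lie under it,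
  so \<open>c + 2\<close> points leave the class, with limiting ratio (1/4)^(c/2+1). The other
  colour contributes only through the 2^(N+2) colourings; the leading 2 is the choice of the
  colour.\<close>

definition arc_density :: "nat \<Rightarrow> real" where
  "arc_density N = 2 * (\<Sum>c\<le>N. real (N choose c) * (mcount c * (1/4) ^ (c div 2 + 1))) / 2 ^ (N + 2)"

lemma iso_density_nonneg: "0 \<le> iso_density N"
  unfolding iso_density_def by (intro divide_nonneg_nonneg mult_nonneg_nonneg sum_nonneg) (auto simp: mcount_nonneg)

lemma sum_Pow_doubleton:
  fixes \<phi> :: "nat set \<Rightarrow> real"
  assumes "i < j"
  shows "(\<Sum>P\<in>Pow {i..j}. if i \<in> P \<and> j \<in> P then \<phi> (P - {i, j}) else 0) = (\<Sum>P\<in>Pow {i<..<j}. \<phi> P)"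
    "(\<Sum>P\<in>Pow {i..j}. if i \<notin> P \<and> j \<notin> P then \<phi> P else 0) = (\<Sum>P\<in>Pow {i<..<j}. \<phi> P)"
proof -
  have "(\<Sum>P\<in>Pow {i..j}. if i \<in> P \<and> j \<in> P then \<phi> (P - {i, j}) else 0) =
      (\<Sum>P\<in>{P \<in> Pow {i..j}. i \<in> P \<and> j \<in> P}. \<phi> (P - {i, j}))"
    by (rule sum.inter_filter[symmetric]) simp
  also have "\<dots> = (\<Sum>P\<in>Pow {i<..<j}. \<phi> P)"
  proof (rule sum.reindex_bij_witness[of _ "\<lambda>P. P \<union> {i, j}" "\<lambda>P. P - {i, j}"], goal_cases)
    case (2 P)
    then show ?case using assms by (auto simp: le_less)
  next
    case (4 P)
    then show ?case using assms by (auto simp: subset_iff less_imp_le)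
  qed auto
  finally show "(\<Sum>P\<in>Pow {i..j}. if i \<in> P \<and> j \<in> P then \<phi> (P - {i, j}) else 0) = (\<Sum>P\<in>Pow {i<..<j}. \<phi> P)" .
  have "{P \<in> Pow {i..j}. i \<notin> P \<and> j \<notin> P} = Pow {i<..<j}"
    by (auto simp: le_less subset_iff; blast)
  then show "(\<Sum>P\<in>Pow {i..j}. if i \<notin> P \<and> j \<notin> P then \<phi> P else 0) = (\<Sum>P\<in>Pow {i<..<j}. \<phi> P)"
    by (subst sum.inter_filter[symmetric]) simp_all
qed

text \<open>A red and a blue arc contribute the same sum over the colourings of the
  interior.\<close>

lemma sum_iso_weight:
  "(\<Sum>P\<in>Pow {i..i + Suc N}. iso_weight i (i + Suc N) P) = iso_density N * 4 ^ (N + 2)"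
proof -
  let ?j = "i + Suc N"
  let ?A = "{i<..<?j}"
  let ?\<phi> = "\<lambda>P. n_matchings P * n_matchings (?A - P)"
  have lt: "i < ?j" by simp
  have cA: "card ?A = N" by simp
  have "(\<Sum>P\<in>Pow {i..?j}. iso_weight i ?j P) =
     (\<Sum>P\<in>Pow {i..?j}. (if i \<in> P \<and> ?j \<in> P then ?\<phi> (P - {i, ?j}) else 0) +
       (if i \<notin> P \<and> ?j \<notin> P then ?\<phi> P else 0))"
  proof (rule sum.cong[OF refl])
    fix P assume P: "P \<in> Pow {i..?j}"
    have 1: "?A - (P - {i, ?j}) = {i..?j} - P" if "i \<in> P" "?j \<in> P"
      using that by (auto simp: le_less)
    have 2: "?A - P = {i..?j} - P - {i, ?j}" by auto
    show "iso_weight i ?j P = (if i \<in> P \<and> ?j \<in> P then ?\<phi> (P - {i, ?j}) else 0) +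
       (if i \<notin> P \<and> ?j \<notin> P then ?\<phi> P else 0)"
      using iso_weight_eq[OF lt, of P] P 1 2 by simp
  qed
  also have "\<dots> = 2 * (\<Sum>P\<in>Pow ?A. ?\<phi> P)"
    unfolding sum.distrib sum_Pow_doubleton[OF lt, of ?\<phi>] by simp
  also have "(\<Sum>P\<in>Pow ?A. ?\<phi> P) = (\<Sum>P\<in>Pow ?A. mcount (card P) * mcount (N - card P))"
  proof (rule sum.cong[OF refl])
    fix P assume P: "P \<in> Pow ?A"
    then have f: "finite P" by (auto intro: finite_subset)
    have "card (?A - P) = N - card P" using P f cA by (simp only: card_Diff_subset Pow_iff)
    then show "?\<phi> P = mcount (card P) * mcount (N - card P)" using f by (simp add: n_matchings_mcount)
  qed
  also have "\<dots> = (\<Sum>c\<le>N. real (N choose c) * (mcount c * mcount (N - c)))"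
    using sum_Pow_card[of ?A "\<lambda>c. mcount c * mcount (N - c)"] cA by simp
  finally show ?thesis by (simp add: iso_density_def)
qed

text \<open>Identifies a summand of \<open>gamma_CP\<close>: odd splittings vanish, and the window
  has 2m+2 points. The 2 on the left is the number of left endpoints per vertex.\<close>

lemma iso_density_even:
  "2 * iso_density (2 * m) = 4 * ((1/16) ^ Suc m * (\<Sum>b\<le>m. real ((2*m) choose (2*b)) * catalan (m - b) * catalan b))"
proof -
  have "(\<Sum>c\<le>2*m. real ((2*m) choose c) * (mcount c * mcount (2*m - c))) =
     (\<Sum>c\<in>{c \<in> {..2*m}. even c}. real ((2*m) choose c) * (mcount c * mcount (2*m - c)))"
    by (rule sum.mono_neutral_right) (auto simp: mcount_def)
  also have "\<dots> = (\<Sum>b\<le>m. real ((2*m) choose (2*b)) * catalan (m - b) * catalan b)"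
    by (rule sum.reindex_bij_witness[of _ "\<lambda>b. 2 * b" "\<lambda>c. c div 2"])
      (auto simp: mcount_def diff_mult_distrib2[symmetric] elim!: evenE)
  finally have "2 * iso_density (2 * m) = 4 * (\<Sum>b\<le>m. real ((2*m) choose (2*b)) * catalan (m - b) * catalan b) / 4 ^ (2 * m + 2)"
    by (simp add: iso_density_def)
  also have "(4::real) ^ (2 * m + 2) = 16 ^ Suc m" by (simp add: power_add power_mult)
  finally show ?thesis by (simp add: power_divide)
qed

lemma iso_density_odd: "odd N \<Longrightarrow> iso_density N = 0"
  unfolding iso_density_def by (auto simp: mcount_def intro!: sum.neutral)

section \<open>Uniform limits for one isolated arc, two isolated arcs, and one arc\<close>

lemma iso_arc_expectation:
  assumes n: "n \<ge> 1" "N + 2 < 2 * n" and i: "1 \<le> i" "i + Suc N \<le> 2 * n"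
  shows "\<bar>measure_pmf.expectation (CP n) (\<lambda>M. of_bool (iso_arc i (i + Suc N) M)) - iso_density N\<bar>
    \<le> (catalan (N + 2))\<^sup>2 * err (N + 2) n"
proof -
  let ?j = "i + Suc N"
  let ?W = "{i..?j}"
  have W: "?W \<subseteq> {1..2*n}" "card ?W = N + 2" using i by auto
  have "\<bar>measure_pmf.expectation (CP n) (\<lambda>M. of_bool (iso_arc i ?j M)) - (\<Sum>P\<in>Pow ?W. iso_weight i ?j P) / 4 ^ card ?W\<bar>
      \<le> (catalan (N + 2))\<^sup>2 * err (card ?W) n"
  proof (rule expectation_window[OF n(1) W(1)])
    show "card ?W < 2 * n" using W n by simp
    show "real (card {p \<in> matching_pairs R ({1..2*n} - R). iso_arc i ?j (fst p \<union> snd p)}) =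
      iso_weight i ?j (R \<inter> ?W) * (n_matchings (R - ?W) * n_matchings ({1..2*n} - R - ?W))" for R
      by (rule count_iso_arc[OF _ W(1)]) simp
    show "0 \<le> iso_weight i ?j P \<and> iso_weight i ?j P \<le> (catalan (N + 2))\<^sup>2" if "P \<subseteq> ?W" for P
      using iso_weight_le[OF that] iso_weight_nonneg by simp
    show "even (card P) \<and> even (card (?W - P))" if "P \<subseteq> ?W" "iso_weight i ?j P \<noteq> 0" for P
      using iso_weight_even[OF that(2,1)] by blast
  qed
  then show ?thesis unfolding sum_iso_weight W(2) by simp
qed

text \<open>The weight of the union is a product of functions of the two disjoint parts, so the sum
  over colourings factorises: asymptotic independence.\<close>

lemma iso_arc_pair_expectation:
  assumes n: "n \<ge> 1" "2 * N + 4 < 2 * n" and i: "1 \<le> i" "i + Suc N \<le> 2 * n"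
    and i': "1 \<le> i'" "i' + Suc N \<le> 2 * n" and disj: "i + Suc N < i' \<or> i' + Suc N < i"
  shows "\<bar>measure_pmf.expectation (CP n) (\<lambda>M. of_bool (iso_arc i (i + Suc N) M \<and> iso_arc i' (i' + Suc N) M)) - (iso_density N)\<^sup>2\<bar>
    \<le> ((catalan (N + 2))\<^sup>2)\<^sup>2 * err (2 * N + 4) n"
proof -
  let ?j = "i + Suc N" and ?j' = "i' + Suc N"
  let ?W = "{i..?j}" and ?W' = "{i'..?j'}"
  let ?h = "\<lambda>P. iso_weight i ?j (P \<inter> ?W) * iso_weight i' ?j' (P \<inter> ?W')"
  let ?C = "(catalan (N + 2))\<^sup>2"
  have W: "?W \<subseteq> {1..2*n}" "?W' \<subseteq> {1..2*n}" "?W \<inter> ?W' = {}" using i i' disj by auto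
  have cU: "card (?W \<union> ?W') = 2 * N + 4" using W(3) by (subst card_Un_disjoint) auto
  have bd: "iso_weight i ?j (P \<inter> ?W) \<le> ?C" "iso_weight i' ?j' (P \<inter> ?W') \<le> ?C" for P
    using iso_weight_le[of "P \<inter> ?W" i ?j] iso_weight_le[of "P \<inter> ?W'" i' ?j'] by simp_all
  have "\<bar>measure_pmf.expectation (CP n) (\<lambda>M. of_bool (iso_arc i ?j M \<and> iso_arc i' ?j' M)) -
      (\<Sum>P\<in>Pow (?W \<union> ?W'). ?h P) / 4 ^ card (?W \<union> ?W')\<bar> \<le> ?C\<^sup>2 * err (card (?W \<union> ?W')) n"
  proof (rule expectation_window[OF n(1)])
    show "?W \<union> ?W' \<subseteq> {1..2*n}" using W by blast
    show "card (?W \<union> ?W') < 2 * n" using cU n by simp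
    fix R
    have "R \<inter> (?W \<union> ?W') \<inter> ?W = R \<inter> ?W" "R \<inter> (?W \<union> ?W') \<inter> ?W' = R \<inter> ?W'" by blast+
    then show "real (card {p \<in> matching_pairs R ({1..2*n} - R). iso_arc i ?j (fst p \<union> snd p) \<and> iso_arc i' ?j' (fst p \<union> snd p)}) =
      ?h (R \<inter> (?W \<union> ?W')) * (n_matchings (R - (?W \<union> ?W')) * n_matchings ({1..2*n} - R - (?W \<union> ?W')))"
      using count_iso_arc_pair[of i ?j "{1..2*n}" i' ?j' R] W by simp
  next
    fix P
    show "0 \<le> ?h P \<and> ?h P \<le> ?C\<^sup>2"
      unfolding power2_eq_square[of ?C] by (intro conjI mult_nonneg_nonneg mult_mono bd iso_weight_nonneg) simp
  next
    fix P assume P: "P \<subseteq> ?W \<union> ?W'" "?h P \<noteq> 0"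
    have fP: "finite P" using P(1) by (rule finite_subset) simp
    have e: "even (card (P \<inter> ?W))" "even (card (?W - P \<inter> ?W))" "even (card (P \<inter> ?W'))" "even (card (?W' - P \<inter> ?W'))"
      using P(2) iso_weight_even[of i ?j "P \<inter> ?W"] iso_weight_even[of i' ?j' "P \<inter> ?W'"] by auto
    have "card P = card (P \<inter> ?W) + card (P \<inter> ?W')"
      using P(1) W(3) fP by (subst card_Un_disjoint[symmetric]) (auto intro!: arg_cong[of _ _ card])
    moreover have "card ((?W \<union> ?W') - P) = card (?W - P \<inter> ?W) + card (?W' - P \<inter> ?W')"
      using W(3) by (subst card_Un_disjoint[symmetric]) (auto intro!: arg_cong[of _ _ card])
    ultimately show "even (card P) \<and> even (card ((?W \<union> ?W') - P))" using e by simp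
  qed
  moreover have "(\<Sum>P\<in>Pow (?W \<union> ?W'). ?h P) = (iso_density N * 4 ^ (N + 2)) * (iso_density N * 4 ^ (N + 2))"
  proof -
    have "(\<Sum>P\<in>Pow (?W \<union> ?W'). ?h P) = (\<Sum>(P, P')\<in>Pow ?W \<times> Pow ?W'. iso_weight i ?j P * iso_weight i' ?j' P')"
    proof (rule sum.reindex_bij_witness[of _ "\<lambda>(P, P'). P \<union> P'" "\<lambda>P. (P \<inter> ?W, P \<inter> ?W')"], goal_cases)
      case (1 P)
      then show ?case by auto
    next
      case (2 P)
      then show ?case by auto
    next
      case (3 p)
      obtain P P' where p: "p = (P, P')" "P \<subseteq> ?W" "P' \<subseteq> ?W'" using 3 by auto
      have "(P \<union> P') \<inter> ?W = P" "(P \<union> P') \<inter> ?W' = P'" using p W(3) by blast+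
      then show ?case using p(1) by simp
    next
      case (4 p)
      then show ?case by auto
    next
      case (5 P)
      then show ?case by simp
    qed
    also have "\<dots> = (\<Sum>P\<in>Pow ?W. iso_weight i ?j P) * (\<Sum>P'\<in>Pow ?W'. iso_weight i' ?j' P')"
      by (simp only: sum_product sum.cartesian_product)
    finally show ?thesis unfolding sum_iso_weight .
  qed
  moreover have "(4::real) ^ (2 * N + 4) = 4 ^ (N + 2) * 4 ^ (N + 2)"
    unfolding power_add[symmetric] by (rule arg_cong[of _ _ "power 4"]) simp
  ultimately show ?thesis unfolding cU by (simp add: power2_eq_square)
qed

text \<open>Containing the arc is an event of a single colour class; the two colours exclude each
  other and have equal averages by symmetry.\<close>

lemma arc_expectation:
  assumes n: "n \<ge> 1" "N + 2 < 2 * n" and i: "1 \<le> i" "i + Suc N \<le> 2 * n"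
  shows "\<bar>measure_pmf.expectation (CP n) (\<lambda>M. of_bool ({i, i + Suc N} \<in> M)) - arc_density N\<bar>
    \<le> 2 * (catalan (N + 2) * err (N + 2) n)"
proof -
  let ?j = "i + Suc N"
  let ?W = "{i..?j}"
  let ?A = "{i<..<?j}"
  let ?V = "{1..2*n}"
  define h where "h = (\<lambda>P. if i \<in> P \<and> ?j \<in> P then n_matchings (P - {i, ?j}) else 0)"
  have lt: "i < ?j" by simp
  have W: "?W \<subseteq> ?V" "card ?W = N + 2" using i by auto
  define F where "F = (\<lambda>R. real (card {M \<in> catalan_matchings R. {i, ?j} \<in> M}) / n_matchings R)"
  have "measure_pmf.expectation (CP n) (\<lambda>M. of_bool ({i, ?j} \<in> M)) = avg n (\<lambda>R. F R + F (?V - R))"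
    unfolding expectation_CP_of_bool[OF n(1)]
  proof (rule avg_cong)
    fix R assume R: "R \<in> even_subsets n"
    let ?B = "?V - R"
    have "real (card {p \<in> matching_pairs R ?B. {i, ?j} \<in> fst p \<union> snd p}) =
      real (card {M \<in> catalan_matchings R. {i, ?j} \<in> M}) * n_matchings ?B +
      n_matchings R * real (card {M \<in> catalan_matchings ?B. {i, ?j} \<in> M})"
      using even_subsets_finite[OF R] by (intro card_matching_pairs_arc) auto
    then show "real (card {p \<in> matching_pairs R ?B. {i, ?j} \<in> fst p \<union> snd p}) / (n_matchings R * n_matchings ?B) =
        F R + F ?B"
      using n_matchings_pos[OF R] by (simp add: F_def add_divide_distrib)
  qed
  also have "\<dots> = 2 * avg n F" unfolding avg_add avg_complement[of n F] by simp
  \<comment> \<open>\<open>rho 0\<close> is constantly 1: a dummy factor for the other colour that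
    gives the expression the shape of \<open>avg_window\<close>.\<close>
  also have "avg n F = avg n (\<lambda>R. h (R \<inter> ?W) * (rho (card (R \<inter> ?W) div 2) (card R div 2) * rho 0 (n - card R div 2)))"
  proof (rule avg_cong)
    fix R assume R: "R \<in> even_subsets n"
    have fR: "finite R" "even (card R)" using R even_subsets_finite[OF R] by (simp_all add: even_subsets_def)
    have r0: "rho 0 k = 1" for k using catalan_pos[of k] by (simp add: rho_def)
    have "real (card {M \<in> catalan_matchings R. {i, ?j} \<in> M}) = h (R \<inter> ?W) * n_matchings (R - ?W)"
      unfolding card_matchings_containing_arc[OF lt] h_def by (simp add: n_matchings_def)
    then have "F R = h (R \<inter> ?W) * (n_matchings (R - ?W) / n_matchings R)" by (simp add: F_def)
    also have "\<dots> = h (R \<inter> ?W) * rho (card (R \<inter> ?W) div 2) (card R div 2)"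
    proof (cases "h (R \<inter> ?W) = 0")
      case False
      then have m: "i \<in> R \<inter> ?W" "?j \<in> R \<inter> ?W" "n_matchings (R \<inter> ?W - {i, ?j}) \<noteq> 0"
        by (auto simp: h_def split: if_splits)
      have "even (card (R \<inter> ?W - {i, ?j}))" using m(3) fR by (auto simp: n_matchings_eq split: if_splits)
      moreover have "card (R \<inter> ?W - {i, ?j}) = card (R \<inter> ?W) - card {i, ?j}"
        using m fR by (intro card_Diff_subset) auto
      moreover have "card {i, ?j} \<le> card (R \<inter> ?W)"
        using m fR by (intro card_mono) auto
      ultimately have "even (card (R \<inter> ?W))" by auto
      then show ?thesis using n_matchings_Diff_ratio[OF fR, of ?W] by simp
    qed simp
    finally show "F R = h (R \<inter> ?W) * (rho (card (R \<inter> ?W) div 2) (card R div 2) * rho 0 (n - card R div 2))"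
      by (simp add: r0)
  qed
  finally have E: "measure_pmf.expectation (CP n) (\<lambda>M. of_bool ({i, ?j} \<in> M)) =
    2 * avg n (\<lambda>R. h (R \<inter> ?W) * (rho (card (R \<inter> ?W) div 2) (card R div 2) * rho 0 (n - card R div 2)))" .
  have "\<bar>avg n (\<lambda>R. h (R \<inter> ?W) * (rho (card (R \<inter> ?W) div 2) (card R div 2) * rho 0 (n - card R div 2)))
      - (\<Sum>P\<in>Pow ?W. h P * (1/4) ^ (card P div 2 + 0)) / 2 ^ card ?W\<bar> \<le> catalan (N + 2) * err (N + 2) n"
  proof (rule avg_window[OF W(1), of h _ "\<lambda>P. card P div 2" _ "\<lambda>_. 0"])
    show "card ?W < 2 * n" using W n by simp
    fix P assume P: "P \<subseteq> ?W"
    have fP: "finite P" using P by (rule finite_subset) simp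
    have "card P \<le> N + 2" using card_mono[OF _ P] by simp
    then show "card P div 2 \<le> N + 2 \<and> 0 \<le> N + 2" by simp
    have "card (P - {i, ?j}) \<le> card P" using fP by (intro card_mono) auto
    then have "n_matchings (P - {i, ?j}) \<le> catalan (N + 2)"
      using fP \<open>card P \<le> N + 2\<close> by (intro n_matchings_le) auto
    then show "0 \<le> h P \<and> h P \<le> catalan (N + 2)"
      using n_matchings_nonneg less_imp_le[OF catalan_pos] by (simp add: h_def)
  qed
  moreover have "(\<Sum>P\<in>Pow ?W. h P * (1/4) ^ (card P div 2 + 0)) =
     (\<Sum>c\<le>N. real (N choose c) * (mcount c * (1/4) ^ (c div 2 + 1)))"
  proof -
    let ?g = "\<lambda>P. mcount (card P) * (1/4::real) ^ (card P div 2 + 1)"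
    have "(\<Sum>P\<in>Pow ?W. h P * (1/4) ^ (card P div 2 + 0)) =
       (\<Sum>P\<in>Pow ?W. if i \<in> P \<and> ?j \<in> P then ?g (P - {i, ?j}) else 0)"
    proof (rule sum.cong[OF refl])
      fix P assume "P \<in> Pow ?W"
      then have fP: "finite P" by (auto intro: finite_subset)
      show "h P * (1/4) ^ (card P div 2 + 0) = (if i \<in> P \<and> ?j \<in> P then ?g (P - {i, ?j}) else 0)"
      proof (cases "i \<in> P \<and> ?j \<in> P")
        case True
        have "card (P - {i, ?j}) = card P - card {i, ?j}"
          using True fP by (intro card_Diff_subset) auto
        moreover have "card {i, ?j} \<le> card P"
          using True fP by (intro card_mono) auto
        ultimately have "card P = card (P - {i, ?j}) + card {i, ?j}" by linarith
        then have "card P div 2 = card (P - {i, ?j}) div 2 + 1" by simp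
        then show ?thesis using True fP by (simp add: h_def n_matchings_mcount)
      qed (auto simp: h_def)
    qed
    also have "\<dots> = (\<Sum>P\<in>Pow ?A. ?g P)" by (rule sum_Pow_doubleton(1)[OF lt])
    also have "\<dots> = (\<Sum>c\<le>N. real (N choose c) * (mcount c * (1/4) ^ (c div 2 + 1)))"
      using sum_Pow_card[of ?A "\<lambda>c. mcount c * (1/4) ^ (c div 2 + 1)"] by simp
    finally show ?thesis .
  qed
  ultimately show ?thesis unfolding E W(2) arc_density_def by (simp add: abs_le_iff algebra_simps)
qed

section \<open>Total mass of the arc densities\<close>

text \<open>Pascal's rule shows that passing from \<open>r\<close> to \<open>Suc r\<close> changes
  the partial sum only by a vanishing boundary term, so every limit equals that of the geometric
  series.\<close>

lemma sum_binomial_half_tendsto: "(\<lambda>L. \<Sum>N<L. real (N choose r) / 2 ^ N) \<longlonglongrightarrow> 2"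
proof (induction r)
  case 0
  have "(\<lambda>N. (1/2::real) ^ N) sums (1 / (1 - 1/2))" by (rule geometric_sums) simp
  then show ?case by (simp add: sums_def power_divide)
next
  case (Suc r)
  have eq: "(\<Sum>N<L. real (N choose Suc r) / 2 ^ N) = (\<Sum>N<L. real (N choose r) / 2 ^ N) - 2 * (real (L choose Suc r) / 2 ^ L)" for L
    by (induction L) (simp_all add: add_divide_distrib)
  have "(\<lambda>L. (\<Sum>N<L. real (N choose r) / 2 ^ N) - 2 * (real (L choose Suc r) / 2 ^ L)) \<longlonglongrightarrow> 2 - 2 * 0"
    by (intro tendsto_diff tendsto_mult Suc binomial_over_pow2_tendsto tendsto_const)
  then show ?case unfolding eq by simp
qed

text \<open>Telescopes: by \<open>catalan_Suc\<close>, each summand is the drop between consecutive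
  values of the central binomial probability binomial(2A, A) / 4^A.\<close>

lemma sum_catalan_quarter: "(\<Sum>a<A. 2 * catalan a * (1/4) ^ (a + 1)) = 1 - real (A + 1) * catalan A / 4 ^ A"
proof (induction A)
  case (Suc A)
  have 1: "real (Suc A + 1) * catalan (Suc A) = real (4 * A + 2) * catalan A"
    using catalan_Suc[of A] by simp
  have 2: "real (A + 1) * catalan A / 4 ^ A - real (4 * A + 2) * catalan A / 4 ^ Suc A = 2 * catalan A * (1/4) ^ (A + 1)"
    by (simp add: divide_simps power_divide) (simp add: algebra_simps)
  show ?case unfolding sum.lessThan_Suc Suc 1 2[symmetric] by simp
qed simp

lemma central_binomial_tendsto: "(\<lambda>A. real (A + 1) * catalan A / 4 ^ A) \<longlonglongrightarrow> 0"
proof -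
  define t where "t = (\<lambda>A. real (A + 1) * catalan A / 4 ^ A)"
  have tS: "t (Suc A) = t A * (real (2 * A + 1) / real (2 * A + 2))" for A
  proof -
    have "real (Suc A + 1) * catalan (Suc A) = real (4 * A + 2) * catalan A"
      using catalan_Suc[of A] by simp
    then have "t (Suc A) = real (4 * A + 2) * catalan A / 4 ^ Suc A" unfolding t_def by simp
    moreover have "real A + 1 \<noteq> 0" by linarith
    ultimately show ?thesis unfolding t_def by (simp add: divide_simps) (simp add: algebra_simps)
  qed
  \<comment> \<open>An elementary substitute for Stirling's formula; the bound is inductive because
    (2A+1)(2A+3) is at most (2A+2)^2.\<close>
  have "(t A)\<^sup>2 * real (2 * A + 1) \<le> 1" for A
  proof (induction A)
    case (Suc A)
    have "(t (Suc A))\<^sup>2 * real (2 * Suc A + 1) =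
      ((t A)\<^sup>2 * real (2 * A + 1)) * (real (2 * A + 1) * real (2 * A + 3) / (real (2 * A + 2))\<^sup>2)"
      unfolding tS by (simp add: power_mult_distrib power_divide power2_eq_square)
    also have "\<dots> \<le> 1 * 1"
    proof (intro mult_mono Suc)
      show "real (2 * A + 1) * real (2 * A + 3) / (real (2 * A + 2))\<^sup>2 \<le> 1"
        by (rule divide_le_eq_1_pos[THEN iffD2]) (simp, simp add: power2_eq_square algebra_simps)
    qed auto
    finally show ?case by simp
  qed (simp add: t_def)
  then have le: "(t A)\<^sup>2 \<le> 1 / real (2 * A + 1)" for A by (simp add: field_simps)
  have "(\<lambda>A. (t A)\<^sup>2) \<longlonglongrightarrow> 0"
  proof (rule Lim_null_comparison)
    show "(\<lambda>A::nat. 1 / real (2 * A + 1)) \<longlonglongrightarrow> 0" by real_asymp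
  qed (use le in simp)
  then have "(\<lambda>A. sqrt ((t A)\<^sup>2)) \<longlonglongrightarrow> sqrt 0" by (rule tendsto_real_sqrt)
  then have "t \<longlonglongrightarrow> 0" by (simp add: tendsto_rabs_zero_iff)
  then show ?thesis unfolding t_def .
qed

text \<open>The local limit loses no mass: every arc is eventually seen at a finite length.\<close>
lemma arc_density_total:
  assumes "\<delta> > 0"
  shows "\<exists>L0. \<forall>L\<ge>L0. (\<Sum>N<L. 2 * arc_density N) \<ge> 1 - \<delta>"
proof -
  \<comment> \<open>Truncating the number \<open>2 * a\<close> of same-coloured points under the arc
    first leaves finitely many terms, in which the limit over lengths can be taken.\<close>
  have "eventually (\<lambda>A. real (A + 1) * catalan A / 4 ^ A < \<delta> / 2) sequentially"
    using order_tendstoD(2)[OF central_binomial_tendsto, of "\<delta> / 2"] assms by (simp only: half_gt_zero)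
  then obtain A where A: "real (A + 1) * catalan A / 4 ^ A < \<delta> / 2"
    by (auto simp: eventually_sequentially)
  let ?w = "\<lambda>a. catalan a * (1/4) ^ (a + 1)"
  have "(\<lambda>L. \<Sum>a<A. ?w a * (\<Sum>N<L. real (N choose (2 * a)) / 2 ^ N)) \<longlonglongrightarrow> (\<Sum>a<A. ?w a * 2)"
    by (intro tendsto_sum tendsto_mult tendsto_const sum_binomial_half_tendsto)
  moreover have "(\<Sum>a<A. ?w a * 2) > 1 - \<delta>"
  proof -
    have "(\<Sum>a<A. ?w a * 2) = (\<Sum>a<A. 2 * catalan a * (1/4) ^ (a + 1))"
      by (rule sum.cong) auto
    also have "\<dots> = 1 - real (A + 1) * catalan A / 4 ^ A" by (rule sum_catalan_quarter)
    finally show ?thesis using A assms by linarith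
  qed
  ultimately have "eventually (\<lambda>L. (\<Sum>a<A. ?w a * (\<Sum>N<L. real (N choose (2 * a)) / 2 ^ N)) > 1 - \<delta>) sequentially"
    by (rule order_tendstoD(1))
  then obtain L0 where L0: "\<And>L. L \<ge> L0 \<Longrightarrow> (\<Sum>a<A. ?w a * (\<Sum>N<L. real (N choose (2 * a)) / 2 ^ N)) > 1 - \<delta>"
    by (auto simp: eventually_sequentially)
  \<comment> \<open>The truncated sum is a part of the nonnegative sum that defines the
    density.\<close>
  have le: "(\<Sum>a<A. ?w a * (real (N choose (2 * a)) / 2 ^ N)) \<le> 2 * arc_density N" for N
  proof -
    let ?f = "\<lambda>c. real (N choose c) * (mcount c * (1/4) ^ (c div 2 + 1))"
    have "(\<Sum>a<A. ?w a * real (N choose (2 * a))) = (\<Sum>c\<in>(\<lambda>a. 2 * a) ` {..<A}. ?f c)"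
      by (subst sum.reindex) (auto simp: inj_on_def mcount_def mult_ac)
    also have "\<dots> = (\<Sum>c\<in>(\<lambda>a. 2 * a) ` {..<A} \<inter> {..N}. ?f c)"
      by (rule sum.mono_neutral_right) (auto simp: binomial_eq_0)
    also have "\<dots> \<le> (\<Sum>c\<le>N. ?f c)"
      by (rule sum_mono2) (auto simp: mcount_nonneg)
    finally have "(\<Sum>a<A. ?w a * real (N choose (2 * a))) / 2 ^ N \<le> (\<Sum>c\<le>N. ?f c) / 2 ^ N"
      by (rule divide_right_mono) simp
    moreover have "2 * arc_density N = (\<Sum>c\<le>N. ?f c) / 2 ^ N"
      unfolding arc_density_def by simp
    ultimately show ?thesis by (simp add: sum_divide_distrib)
  qed
  have "1 - \<delta> \<le> (\<Sum>N<L. 2 * arc_density N)" if "L \<ge> L0" for L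
  proof -
    have "1 - \<delta> \<le> (\<Sum>a<A. ?w a * (\<Sum>N<L. real (N choose (2 * a)) / 2 ^ N))"
      using L0[OF that] by simp
    also have "\<dots> = (\<Sum>N<L. \<Sum>a<A. ?w a * (real (N choose (2 * a)) / 2 ^ N))"
      unfolding sum_distrib_left by (rule sum.swap)
    also have "\<dots> \<le> (\<Sum>N<L. 2 * arc_density N)" by (intro sum_mono le)
    finally show ?thesis .
  qed
  then show ?thesis by blast
qed

section \<open>Second moment and convergence of the counts\<close>

definition iso_count :: "nat \<Rightarrow> nat \<Rightarrow> nat set set \<Rightarrow> real" where
  "iso_count n N M = (\<Sum>i\<in>{1..2*n - Suc N}. of_bool (iso_arc i (i + Suc N) M))"

definition arc_count :: "nat \<Rightarrow> nat \<Rightarrow> nat set set \<Rightarrow> real" where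
  "arc_count n N M = (\<Sum>i\<in>{1..2*n - Suc N}. of_bool ({i, i + Suc N} \<in> M))"

lemma integrable_CP: "n \<ge> 1 \<Longrightarrow> integrable (CP n) (f :: nat set set \<Rightarrow> real)"
  by (rule integrable_measure_pmf_finite) (rule finite_set_pmf_CP)

text \<open>Centring at the limit value \<open>p\<close> instead of the true mean lets the
  one-window and two-window estimates enter directly. Each left endpoint has at most 2N+3 others
  with overlapping windows, itself included; these pairs get the trivial bound, the others
  \<open>D\<close>.\<close>

lemma iso_count_second_moment:
  assumes n: "n \<ge> 1" "2 * N + 4 < 2 * n"
  defines "p \<equiv> iso_density N" and "m \<equiv> 2 * n - Suc N"
  shows "measure_pmf.expectation (CP n) (\<lambda>M. (iso_count n N M - real m * p)\<^sup>2) \<le>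
    real m * (real (2 * N + 3) * (1 + p)\<^sup>2) + (real m)\<^sup>2 *
     (((catalan (N + 2))\<^sup>2)\<^sup>2 * err (2 * N + 4) n + 2 * p * ((catalan (N + 2))\<^sup>2 * err (N + 2) n))"
proof -
  let ?E = "measure_pmf.expectation (CP n)"
  define X where "X = (\<lambda>i M. of_bool (iso_arc i (i + Suc N) M) :: real)"
  define D where "D = ((catalan (N + 2))\<^sup>2)\<^sup>2 * err (2 * N + 4) n + 2 * p * ((catalan (N + 2))\<^sup>2 * err (N + 2) n)"
  let ?I = "{1..m}"
  have p0: "p \<ge> 0" unfolding p_def by (rule iso_density_nonneg)
  have D0: "D \<ge> 0" unfolding D_def using p0 err_nonneg by (intro add_nonneg_nonneg mult_nonneg_nonneg) auto
  note int = integrable_CP[OF n(1)]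
  have term_le: "?E (\<lambda>M. (X i M - p) * (X i' M - p)) \<le> (1 + p)\<^sup>2 * of_bool (i' \<in> {i - Suc N..i + Suc N}) + D"
    if i: "i \<in> ?I" and i': "i' \<in> ?I" for i i'
  proof (cases "i' \<in> {i - Suc N..i + Suc N}")
    case True
    have "?E (\<lambda>M. (X i M - p) * (X i' M - p)) \<le> ?E (\<lambda>M. (1 + p)\<^sup>2)"
    proof (rule integral_mono[OF int int])
      fix M
      have b: "\<bar>X k M - p\<bar> \<le> 1 + p" for k using p0 by (auto simp: X_def abs_if of_bool_def)
      have "(X i M - p) * (X i' M - p) \<le> \<bar>X i M - p\<bar> * \<bar>X i' M - p\<bar>"
        by (simp only: abs_mult[symmetric] abs_ge_self)
      also have "\<dots> \<le> (1 + p) * (1 + p)" using b[of i] b[of i'] p0 by (intro mult_mono) auto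
      finally show "(X i M - p) * (X i' M - p) \<le> (1 + p)\<^sup>2" by (simp add: power2_eq_square)
    qed
    then show ?thesis using True D0 by simp
  next
    case False
    have bds: "1 \<le> i" "i + Suc N \<le> 2 * n" "1 \<le> i'" "i' + Suc N \<le> 2 * n" using i i' by (auto simp: m_def)
    have disj: "i + Suc N < i' \<or> i' + Suc N < i" using False by auto
    have a: "\<bar>?E (\<lambda>M. of_bool (iso_arc i (i + Suc N) M \<and> iso_arc i' (i' + Suc N) M)) - p\<^sup>2\<bar>
        \<le> ((catalan (N + 2))\<^sup>2)\<^sup>2 * err (2 * N + 4) n"
      unfolding p_def by (rule iso_arc_pair_expectation[OF n bds disj])
    have n': "N + 2 < 2 * n" using n by simp
    have b: "\<bar>?E (X k) - p\<bar> \<le> (catalan (N + 2))\<^sup>2 * err (N + 2) n" if "k = i \<or> k = i'" for k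
      unfolding p_def X_def using iso_arc_expectation[OF n(1) n'] bds that by blast
    have "?E (\<lambda>M. (X i M - p) * (X i' M - p)) =
        ?E (\<lambda>M. of_bool (iso_arc i (i + Suc N) M \<and> iso_arc i' (i' + Suc N) M) - p * X i M - p * X i' M + p\<^sup>2)"
      by (rule arg_cong[of _ _ ?E]) (auto simp: X_def fun_eq_iff power2_eq_square algebra_simps)
    also have "\<dots> = ?E (\<lambda>M. of_bool (iso_arc i (i + Suc N) M \<and> iso_arc i' (i' + Suc N) M)) - p * ?E (X i) - p * ?E (X i') + p\<^sup>2"
      by (simp add: int)
    also have "\<dots> = (?E (\<lambda>M. of_bool (iso_arc i (i + Suc N) M \<and> iso_arc i' (i' + Suc N) M)) - p\<^sup>2)
        + p * (p - ?E (X i)) + p * (p - ?E (X i'))"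
      by (simp add: power2_eq_square algebra_simps)
    also have "\<dots> \<le> ((catalan (N + 2))\<^sup>2)\<^sup>2 * err (2 * N + 4) n + p * ((catalan (N + 2))\<^sup>2 * err (N + 2) n)
        + p * ((catalan (N + 2))\<^sup>2 * err (N + 2) n)"
      using a b[of i] b[of i'] p0 by (intro add_mono mult_left_mono) auto
    also have "\<dots> = D" by (simp add: D_def)
    finally show ?thesis using False by (simp only: of_bool_eq mult_zero_right add_0_left)
  qed
  have "(iso_count n N M - real m * p)\<^sup>2 = (\<Sum>i\<in>?I. \<Sum>i'\<in>?I. (X i M - p) * (X i' M - p))" for M
  proof -
    have "iso_count n N M - real m * p = (\<Sum>i\<in>?I. X i M - p)"
      by (simp add: iso_count_def X_def sum_subtractf m_def)
    then show ?thesis by (simp only: power2_eq_square sum_product)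
  qed
  then have "?E (\<lambda>M. (iso_count n N M - real m * p)\<^sup>2) = (\<Sum>i\<in>?I. \<Sum>i'\<in>?I. ?E (\<lambda>M. (X i M - p) * (X i' M - p)))"
    by (simp add: int)
  also have "\<dots> \<le> (\<Sum>i\<in>?I. \<Sum>i'\<in>?I. (1 + p)\<^sup>2 * of_bool (i' \<in> {i - Suc N..i + Suc N}) + D)"
    by (intro sum_mono term_le)
  also have "\<dots> \<le> (\<Sum>i\<in>?I. (1 + p)\<^sup>2 * real (2 * N + 3) + real m * D)"
  proof (rule sum_mono)
    fix i
    have "card (?I \<inter> {i - Suc N..i + Suc N}) \<le> card {i - Suc N..i + Suc N}" by (rule card_mono) auto
    also have "\<dots> \<le> 2 * N + 3" by simp
    finally have c: "real (card (?I \<inter> {i - Suc N..i + Suc N})) \<le> real (2 * N + 3)" by (rule of_nat_mono)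
    have "(\<Sum>i'\<in>?I. (1 + p)\<^sup>2 * of_bool (i' \<in> {i - Suc N..i + Suc N}) + D) =
        (1 + p)\<^sup>2 * (\<Sum>i'\<in>?I. of_bool (i' \<in> {i - Suc N..i + Suc N})) + real m * D"
      by (simp add: sum.distrib sum_distrib_left)
    also have "(\<Sum>i'\<in>?I. of_bool (i' \<in> {i - Suc N..i + Suc N}) :: real) = real (card (?I \<inter> {i - Suc N..i + Suc N}))"
      by (subst sum_of_bool_eq) (simp_all add: Int_def)
    finally show "(\<Sum>i'\<in>?I. (1 + p)\<^sup>2 * of_bool (i' \<in> {i - Suc N..i + Suc N}) + D) \<le> (1 + p)\<^sup>2 * real (2 * N + 3) + real m * D"
      using mult_left_mono[OF c, of "(1 + p)\<^sup>2"] by simp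
  qed
  also have "\<dots> = real m * (real (2 * N + 3) * (1 + p)\<^sup>2) + (real m)\<^sup>2 * D"
    by (simp add: power2_eq_square algebra_simps)
  finally show ?thesis unfolding D_def .
qed

lemma expectation_abs_le_sqrt:
  assumes "n \<ge> 1"
  shows "measure_pmf.expectation (CP n) (\<lambda>M. \<bar>f M\<bar>) \<le> sqrt (measure_pmf.expectation (CP n) (\<lambda>M. (f M)\<^sup>2))"
proof -
  note int = integrable_CP[OF assms]
  have "0 \<le> measure_pmf.variance (CP n) (\<lambda>M. \<bar>f M\<bar>)"
    by (rule measure_pmf.variance_positive)
  also have "\<dots> = measure_pmf.expectation (CP n) (\<lambda>M. \<bar>f M\<bar>\<^sup>2) - (measure_pmf.expectation (CP n) (\<lambda>M. \<bar>f M\<bar>))\<^sup>2"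
    by (rule measure_pmf.variance_eq) (rule int)+
  finally show ?thesis by (intro real_le_rsqrt) simp
qed

text \<open>There are m = 2n - Suc N positions, hence the limit 2p. After division by n^2 the second
  moment is at most 2K/n + 4D, and recentring from mp/n to 2p costs a term of order 1/n.\<close>

lemma iso_count_tendsto:
  "(\<lambda>n. measure_pmf.expectation (CP n) (\<lambda>M. \<bar>iso_count n N M / real n - 2 * iso_density N\<bar>)) \<longlonglongrightarrow> 0"
proof -
  define p where "p = iso_density N"
  define K where "K = real (2 * N + 3) * (1 + p)\<^sup>2"
  define D where "D = (\<lambda>n. ((catalan (N + 2))\<^sup>2)\<^sup>2 * err (2 * N + 4) n + 2 * p * ((catalan (N + 2))\<^sup>2 * err (N + 2) n))"
  have p0: "p \<ge> 0" unfolding p_def by (rule iso_density_nonneg)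
  have K0: "K \<ge> 0" by (simp add: K_def)
  have D0: "D n \<ge> 0" for n unfolding D_def using p0 err_nonneg by (intro add_nonneg_nonneg mult_nonneg_nonneg) auto
  have "D \<longlonglongrightarrow> ((catalan (N + 2))\<^sup>2)\<^sup>2 * 0 + 2 * p * ((catalan (N + 2))\<^sup>2 * 0)"
    unfolding D_def by (intro tendsto_add tendsto_mult tendsto_const err_tendsto)
  then have Dlim: "D \<longlonglongrightarrow> 0" by simp
  have "(\<lambda>n. sqrt (2 * K * (1 / real n) + 4 * D n) + real (Suc N) * p * (1 / real n)) \<longlonglongrightarrow> sqrt (2 * K * 0 + 4 * 0) + real (Suc N) * p * 0"
    by (intro tendsto_add tendsto_mult tendsto_const tendsto_real_sqrt Dlim lim_1_over_n)
  then have lim: "(\<lambda>n. sqrt (2 * K * (1 / real n) + 4 * D n) + real (Suc N) * p * (1 / real n)) \<longlonglongrightarrow> 0" by simp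
  show ?thesis
  proof (rule Lim_null_comparison[OF _ lim])
    show "\<forall>\<^sub>F n in sequentially. norm (measure_pmf.expectation (CP n) (\<lambda>M. \<bar>iso_count n N M / real n - 2 * iso_density N\<bar>))
       \<le> sqrt (2 * K * (1 / real n) + 4 * D n) + real (Suc N) * p * (1 / real n)"
      using eventually_ge_at_top[of "N + 3"]
    proof eventually_elim
      case (elim n)
      let ?E = "measure_pmf.expectation (CP n)"
      define m where "m = 2 * n - Suc N"
      \<comment> \<open>The threshold \<open>N + 3\<close> leaves room for two disjoint windows and
        a point outside both, as \<open>avg_local\<close> requires.\<close>
      have n: "n \<ge> 1" "2 * N + 4 < 2 * n" using elim by auto
      note int = integrable_CP[OF n(1)]
      have m: "real m = 2 * real n - real (Suc N)" using n by (simp add: m_def of_nat_diff)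
      have m2: "real m \<le> 2 * real n" using m by simp
      have "?E (\<lambda>M. (iso_count n N M - real m * p)\<^sup>2) \<le> real m * K + (real m)\<^sup>2 * D n"
        using iso_count_second_moment[OF n] unfolding p_def m_def K_def D_def .
      also have "\<dots> \<le> (2 * real n) * K + (2 * real n)\<^sup>2 * D n"
        using m2 K0 D0 by (intro add_mono mult_right_mono power_mono) auto
      finally have "?E (\<lambda>M. (iso_count n N M - real m * p)\<^sup>2) / (real n)\<^sup>2 \<le> ((2 * real n) * K + (2 * real n)\<^sup>2 * D n) / (real n)\<^sup>2"
        by (rule divide_right_mono) simp
      also have "\<dots> = 2 * K * (1 / real n) + 4 * D n"
        using n by (simp add: power2_eq_square field_simps)
      finally have sm: "?E (\<lambda>M. (iso_count n N M - real m * p)\<^sup>2) / (real n)\<^sup>2 \<le> 2 * K * (1 / real n) + 4 * D n" .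
      have "?E (\<lambda>M. \<bar>iso_count n N M / real n - 2 * p\<bar>) \<le>
          ?E (\<lambda>M. \<bar>iso_count n N M - real m * p\<bar> / real n + real (Suc N) * p * (1 / real n))"
      proof (rule integral_mono[OF int int])
        fix M
        have "iso_count n N M / real n - 2 * p = (iso_count n N M - real m * p) / real n - real (Suc N) * p * (1 / real n)"
          using n unfolding m by (simp add: field_simps)
        also have "\<bar>\<dots>\<bar> \<le> \<bar>(iso_count n N M - real m * p) / real n\<bar> + \<bar>real (Suc N) * p * (1 / real n)\<bar>"
          by (rule abs_triangle_ineq4)
        also have "\<dots> = \<bar>iso_count n N M - real m * p\<bar> / real n + real (Suc N) * p * (1 / real n)"
          using p0 by (simp add: abs_mult)
        finally show "\<bar>iso_count n N M / real n - 2 * p\<bar> \<le> \<bar>iso_count n N M - real m * p\<bar> / real n + real (Suc N) * p * (1 / real n)" .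
      qed
      also have "\<dots> = ?E (\<lambda>M. \<bar>iso_count n N M - real m * p\<bar>) / real n + real (Suc N) * p * (1 / real n)"
        by (simp add: int)
      also have "?E (\<lambda>M. \<bar>iso_count n N M - real m * p\<bar>) / real n \<le> sqrt (?E (\<lambda>M. (iso_count n N M - real m * p)\<^sup>2)) / real n"
        by (intro divide_right_mono expectation_abs_le_sqrt n) simp
      also have "\<dots> = sqrt (?E (\<lambda>M. (iso_count n N M - real m * p)\<^sup>2) / (real n)\<^sup>2)"
        by (simp add: real_sqrt_divide)
      also have "\<dots> \<le> sqrt (2 * K * (1 / real n) + 4 * D n)" using sm by (rule real_sqrt_le_mono)
      finally have "?E (\<lambda>M. \<bar>iso_count n N M / real n - 2 * p\<bar>) \<le> sqrt (2 * K * (1 / real n) + 4 * D n) + real (Suc N) * p * (1 / real n)"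
        by simp
      moreover have "0 \<le> ?E (\<lambda>M. \<bar>iso_count n N M / real n - 2 * p\<bar>)" by (rule Bochner_Integration.integral_nonneg) simp
      ultimately show ?case by (simp add: p_def)
    qed
  qed
qed

text \<open>Convergence of the mean suffices, since arcs are used only to bound the expected number
  of long ones.\<close>

lemma arc_count_tendsto:
  "(\<lambda>n. measure_pmf.expectation (CP n) (\<lambda>M. arc_count n N M / real n)) \<longlonglongrightarrow> 2 * arc_density N"
proof -
  define q where "q = arc_density N"
  define e where "e = (\<lambda>n. 2 * (catalan (N + 2) * err (N + 2) n))"
  have "e \<longlonglongrightarrow> 2 * (catalan (N + 2) * 0)"
    unfolding e_def by (intro tendsto_mult tendsto_const err_tendsto)
  then have elim0: "e \<longlonglongrightarrow> 0" by simp
  have "(\<lambda>n. real (Suc N) * \<bar>q\<bar> * (1 / real n) + 2 * e n) \<longlonglongrightarrow> real (Suc N) * \<bar>q\<bar> * 0 + 2 * 0"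
    by (intro tendsto_add tendsto_mult tendsto_const elim0 lim_1_over_n)
  then have lim: "(\<lambda>n. real (Suc N) * \<bar>q\<bar> * (1 / real n) + 2 * e n) \<longlonglongrightarrow> 0" by simp
  have "(\<lambda>n. measure_pmf.expectation (CP n) (\<lambda>M. arc_count n N M / real n) - 2 * q) \<longlonglongrightarrow> 0"
  proof (rule Lim_null_comparison[OF _ lim])
    show "\<forall>\<^sub>F n in sequentially. norm (measure_pmf.expectation (CP n) (\<lambda>M. arc_count n N M / real n) - 2 * q)
       \<le> real (Suc N) * \<bar>q\<bar> * (1 / real n) + 2 * e n"
      using eventually_ge_at_top[of "N + 3"]
    proof eventually_elim
      case (elim n)
      let ?E = "measure_pmf.expectation (CP n)"
      define m where "m = 2 * n - Suc N"
      have n: "n \<ge> 1" "N + 2 < 2 * n" using elim by auto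
      note int = integrable_CP[OF n(1)]
      have m: "real m = 2 * real n - real (Suc N)" using n by (simp add: m_def of_nat_diff)
      have e0: "e n \<ge> 0" unfolding e_def using err_nonneg less_imp_le[OF catalan_pos] by simp
      define y where "y = (\<lambda>i. ?E (\<lambda>M. of_bool ({i, i + Suc N} \<in> M)) - q)"
      have y: "\<bar>y i\<bar> \<le> e n" if "i \<in> {1..m}" for i
        unfolding y_def q_def e_def by (rule arc_expectation[OF n]) (use that in \<open>auto simp: m_def\<close>)
      have "?E (arc_count n N) = (\<Sum>i\<in>{1..m}. ?E (\<lambda>M. of_bool ({i, i + Suc N} \<in> M)))"
        unfolding arc_count_def m_def by (rule Bochner_Integration.integral_sum) (rule int)
      also have "\<dots> = (\<Sum>i\<in>{1..m}. q + y i)" by (simp add: y_def)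
      also have "\<dots> = real m * q + (\<Sum>i\<in>{1..m}. y i)" by (simp add: sum.distrib)
      finally have E: "?E (arc_count n N) = real m * q + (\<Sum>i\<in>{1..m}. y i)" .
      have "\<bar>\<Sum>i\<in>{1..m}. y i\<bar> \<le> (\<Sum>i\<in>{1..m}. e n)"
        by (rule order_trans[OF sum_abs sum_mono]) (rule y)
      also have "\<dots> \<le> 2 * real n * e n" using m e0 by (simp add: mult_right_mono)
      finally have Y: "\<bar>\<Sum>i\<in>{1..m}. y i\<bar> / real n \<le> 2 * e n" using n by (simp add: field_simps)
      have "?E (\<lambda>M. arc_count n N M / real n) - 2 * q = (\<Sum>i\<in>{1..m}. y i) / real n - real (Suc N) * q * (1 / real n)"
        using n E unfolding m by (simp add: field_simps)
      also have "\<bar>\<dots>\<bar> \<le> \<bar>(\<Sum>i\<in>{1..m}. y i) / real n\<bar> + \<bar>real (Suc N) * q * (1 / real n)\<bar>"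
        by (rule abs_triangle_ineq4)
      also have "\<dots> \<le> 2 * e n + real (Suc N) * \<bar>q\<bar> * (1 / real n)"
        using Y by (simp add: abs_mult)
      finally show ?case by simp
    qed
  qed
  then show ?thesis unfolding q_def by (simp add: LIM_zero_iff)
qed

section \<open>Law of large numbers\<close>

lemma CP_perfect_matching:
  assumes "n \<ge> 1" "M \<in> set_pmf (CP n)"
  shows "perfect_matching {1..2*n} M"
proof -
  obtain R p where R: "R \<in> even_subsets n" and p: "p \<in> matching_pairs R ({1..2*n} - R)" "M = fst p \<union> snd p"
    using assms(2) unfolding set_pmf_CP[OF assms(1)] by blast
  have "fst p \<in> catalan_matchings R" "snd p \<in> catalan_matchings ({1..2*n} - R)"
    using p(1) by (auto simp: matching_pairs_def)
  then have "perfect_matching (R \<union> ({1..2*n} - R)) M"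
    unfolding p(2) by (intro perfect_matching_Un catalan_matchingsD(1)) auto
  moreover have "R \<union> ({1..2*n} - R) = {1..2*n}" using R by (auto simp: even_subsets_def)
  ultimately show ?thesis by simp
qed

text \<open>The open predicate \<open>Q\<close> covers both the isolated arcs and all arcs.\<close>

lemma card_arcs_by_length:
  assumes M: "perfect_matching {1..2*n} M"
  shows "real (card {e \<in> M. Q e}) =
    (\<Sum>N<2*n. \<Sum>i\<in>{1..2*n - Suc N}. of_bool ({i, i + Suc N} \<in> M \<and> Q {i, i + Suc N}))"
proof -
  let ?S = "SIGMA N:{..<2*n}. {1..2*n - Suc N}"
  let ?f = "\<lambda>(N, i). {i, i + Suc N}"
  let ?T = "{x \<in> ?S. ?f x \<in> M \<and> Q (?f x)}"
  have "bij_betw ?f ?T {e \<in> M. Q e}"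
  proof (rule bij_betwI')
    fix x y
    show "?f x = ?f y \<longleftrightarrow> x = y"
      by (cases x; cases y) (auto simp: doubleton_eq_iff)
  next
    fix x assume "x \<in> ?T"
    then show "?f x \<in> {e \<in> M. Q e}" by simp
  next
    fix e assume e: "e \<in> {e \<in> M. Q e}"
    then obtain a b where ab: "a < b" "e = {a, b}" "a \<in> {1..2*n}" "b \<in> {1..2*n}"
      using matching_arcE[OF M, of e] by blast
    then have "(b - a - 1, a) \<in> ?S" "e = ?f (b - a - 1, a)" by auto
    then show "\<exists>x\<in>?T. e = ?f x" using e by blast
  qed
  then have "real (card {e \<in> M. Q e}) = real (card ?T)" by (simp add: bij_betw_same_card)
  also have "\<dots> = (\<Sum>x\<in>?S. of_bool (?f x \<in> M \<and> Q (?f x)))"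
    by (subst sum_of_bool_eq) (auto simp: Int_def)
  also have "\<dots> = (\<Sum>N<2*n. \<Sum>i\<in>{1..2*n - Suc N}. of_bool ({i, i + Suc N} \<in> M \<and> Q {i, i + Suc N}))"
    by (subst sum.Sigma) (auto simp: split_beta)
  finally show ?thesis .
qed

lemma isolated_count_eq:
  assumes M: "perfect_matching {1..2*n} M"
  shows "real (isolated_count M) = (\<Sum>N<2*n. iso_count n N M)"
proof -
  have "{i, i + Suc N} \<in> M \<and> \<not> (\<exists>f\<in>M. arcs_cross {i, i + Suc N} f) \<longleftrightarrow> iso_arc i (i + Suc N) M" for i N
    using matching_not_crossing_iff[OF M, of i "i + Suc N"] unfolding iso_arc_def by auto
  then show ?thesis
    unfolding isolated_count_def card_arcs_by_length[OF M] iso_count_def by simp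
qed

lemma sum_arc_count:
  assumes M: "perfect_matching {1..2*n} M"
  shows "(\<Sum>N<2*n. arc_count n N M) = real n"
proof -
  have "card M = n" using matching_card[OF M] by simp
  then show ?thesis using card_arcs_by_length[OF M, of "\<lambda>_. True"] unfolding arc_count_def by simp
qed

lemma iso_count_nonneg: "0 \<le> iso_count n N M"
  unfolding iso_count_def by (rule sum_nonneg) simp

lemma iso_count_le_arc_count: "iso_count n N M \<le> arc_count n N M"
  unfolding iso_count_def arc_count_def by (rule sum_mono) (simp add: iso_arc_def)

lemma expectation_mono_CP:
  fixes f g :: "nat set set \<Rightarrow> real"
  assumes "n \<ge> 1" "\<And>M. perfect_matching {1..2*n} M \<Longrightarrow> f M \<le> g M"
  shows "measure_pmf.expectation (CP n) f \<le> measure_pmf.expectation (CP n) g"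
  by (rule integral_mono_AE) (use assms CP_perfect_matching integrable_CP in \<open>auto simp: AE_measure_pmf_iff\<close>)

text \<open>For finite n the isolated arcs of bounded length number at most n; the bound passes to
  the limit. This yields summability of the series for \<open>gamma_CP\<close> without estimating
  its terms.\<close>

lemma sum_iso_density_le: "(\<Sum>N<L. 2 * iso_density N) \<le> 1"
proof -
  have "(\<lambda>n. 1 + (\<Sum>N<L. measure_pmf.expectation (CP n) (\<lambda>M. \<bar>iso_count n N M / real n - 2 * iso_density N\<bar>))) \<longlonglongrightarrow> 1 + 0"
    by (intro tendsto_add tendsto_const tendsto_null_sum iso_count_tendsto)
  moreover have "(\<Sum>N<L. 2 * iso_density N) \<le> 1 + (\<Sum>N<L. measure_pmf.expectation (CP n) (\<lambda>M. \<bar>iso_count n N M / real n - 2 * iso_density N\<bar>))"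
    if n: "n \<ge> L + 1" for n
  proof -
    let ?E = "measure_pmf.expectation (CP n)"
    have n1: "n \<ge> 1" using n by simp
    have "(\<Sum>N<L. 2 * iso_density N) = ?E (\<lambda>_. \<Sum>N<L. 2 * iso_density N)" by simp
    also have "\<dots> \<le> ?E (\<lambda>M. 1 + (\<Sum>N<L. \<bar>iso_count n N M / real n - 2 * iso_density N\<bar>))"
    proof (rule expectation_mono_CP[OF n1])
      fix M assume M: "perfect_matching {1..2*n} M"
      have "(\<Sum>N<L. iso_count n N M) \<le> (\<Sum>N<2*n. iso_count n N M)"
        by (rule sum_mono2) (use n iso_count_nonneg in auto)
      also have "\<dots> \<le> (\<Sum>N<2*n. arc_count n N M)" by (intro sum_mono iso_count_le_arc_count)
      finally have "(\<Sum>N<L. iso_count n N M) / real n \<le> 1" using n1 sum_arc_count[OF M] by simp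
      moreover have "(\<Sum>N<L. 2 * iso_density N) \<le> (\<Sum>N<L. iso_count n N M / real n + \<bar>iso_count n N M / real n - 2 * iso_density N\<bar>)"
        by (intro sum_mono) linarith
      ultimately show "(\<Sum>N<L. 2 * iso_density N) \<le> 1 + (\<Sum>N<L. \<bar>iso_count n N M / real n - 2 * iso_density N\<bar>)"
        by (simp add: sum.distrib sum_divide_distrib)
    qed
    also have "\<dots> = 1 + (\<Sum>N<L. ?E (\<lambda>M. \<bar>iso_count n N M / real n - 2 * iso_density N\<bar>))"
      by (simp add: integrable_CP[OF n1])
    finally show ?thesis .
  qed
  ultimately show ?thesis by (intro LIMSEQ_le_const[where x = "1::real"]) auto
qed

text \<open>Odd N contribute nothing, so the series over lengths is reindexed by N = 2m.\<close>

lemma iso_density_sums: "(\<lambda>N. 2 * iso_density N) sums gamma_CP"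
proof -
  have s: "summable (\<lambda>N. 2 * iso_density N)"
    by (rule summableI_nonneg_bounded[of _ 1]) (simp_all add: iso_density_nonneg sum_iso_density_le)
  let ?g = "\<lambda>m::nat. 2 * m"
  have g: "strict_mono ?g" by (simp add: strict_mono_def)
  have z: "2 * iso_density N = 0" if "N \<notin> range ?g" for N
    using that iso_density_odd[of N] by (auto elim: evenE)
  let ?t = "\<lambda>m. (1/16) ^ Suc m * (\<Sum>b\<le>m. real ((2*m) choose (2*b)) * catalan (m - b) * catalan b)"
  have eq: "2 * iso_density (2 * m) = 4 * ?t m" for m by (rule iso_density_even)
  have "summable (\<lambda>m. 2 * iso_density (2 * m))"
    using summable_mono_reindex[of ?g "\<lambda>N. 2 * iso_density N", OF g z] s by simp
  then have "summable (\<lambda>m. 4 * ?t m)" unfolding eq .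
  then have st: "summable ?t" by (subst (asm) summable_cmult_iff) simp
  have "(\<Sum>N. 2 * iso_density N) = (\<Sum>m. 2 * iso_density (2 * m))"
    using suminf_mono_reindex[of ?g "\<lambda>N. 2 * iso_density N", OF g z] by simp
  also have "\<dots> = gamma_CP" unfolding eq gamma_CP_def by (rule suminf_mult[OF st])
  finally show ?thesis using summable_sums[OF s] by simp
qed

text \<open>Arcs between neighbouring points already have positive density. Asymptotic equivalence
  needs a nonzero constant.\<close>

lemma gamma_CP_pos: "gamma_CP > 0"
proof -
  have "2 * iso_density 0 \<le> gamma_CP"
    using sum_le_suminf[of "\<lambda>N. 2 * iso_density N" "{0}"] iso_density_sums iso_density_nonneg
    by (simp add: sums_iff)
  moreover have "iso_density 0 > 0" by (simp add: iso_density_def mcount_def)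
  ultimately show ?thesis by simp
qed

lemma isolated_count_L1:
  "(\<lambda>n. measure_pmf.expectation (CP n) (\<lambda>M. \<bar>real (isolated_count M) / real n - gamma_CP\<bar>)) \<longlonglongrightarrow> 0"
proof (rule LIMSEQ_I)
  fix \<epsilon> :: real assume \<epsilon>: "0 < \<epsilon>"
  obtain L1 where L1: "\<And>L. L \<ge> L1 \<Longrightarrow> (\<Sum>N<L. 2 * arc_density N) \<ge> 1 - \<epsilon> / 3"
    using arc_density_total[of "\<epsilon> / 3"] \<epsilon> by auto
  obtain L2 where L2: "\<And>L. L \<ge> L2 \<Longrightarrow> \<bar>(\<Sum>N<L. 2 * iso_density N) - gamma_CP\<bar> < \<epsilon> / 3"
    using LIMSEQ_D[OF iso_density_sums[unfolded sums_def], of "\<epsilon> / 3"] \<epsilon> by auto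
  \<comment> \<open>The cutoff is fixed before n grows, so only finitely many lengths need a
    limit.\<close>
  define L where "L = max L1 L2"
  define T where "T = (\<lambda>n. (\<Sum>N<L. measure_pmf.expectation (CP n) (\<lambda>M. \<bar>iso_count n N M / real n - 2 * iso_density N\<bar>))
     + (1 - (\<Sum>N<L. measure_pmf.expectation (CP n) (\<lambda>M. arc_count n N M / real n))) + \<bar>(\<Sum>N<L. 2 * iso_density N) - gamma_CP\<bar>)"
  have "T \<longlonglongrightarrow> 0 + (1 - (\<Sum>N<L. 2 * arc_density N)) + \<bar>(\<Sum>N<L. 2 * iso_density N) - gamma_CP\<bar>"
    unfolding T_def
    by (intro tendsto_add tendsto_diff tendsto_const tendsto_null_sum tendsto_sum iso_count_tendsto arc_count_tendsto)
  moreover have "0 + (1 - (\<Sum>N<L. 2 * arc_density N)) + \<bar>(\<Sum>N<L. 2 * iso_density N) - gamma_CP\<bar> < \<epsilon>"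
    using L1[of L] L2[of L] \<epsilon> by (simp add: L_def)
  ultimately have "eventually (\<lambda>n. T n < \<epsilon>) sequentially" by (rule order_tendstoD(2))
  then obtain n0 where n0: "\<And>n. n \<ge> n0 \<Longrightarrow> T n < \<epsilon>" by (auto simp: eventually_sequentially)
  have "norm (measure_pmf.expectation (CP n) (\<lambda>M. \<bar>real (isolated_count M) / real n - gamma_CP\<bar>) - 0) < \<epsilon>"
    if n: "n \<ge> max n0 (L + 1)" for n
  proof -
    let ?E = "measure_pmf.expectation (CP n)"
    have n1: "n \<ge> 1" "L \<le> 2 * n" using n by auto
    note int = integrable_CP[OF n1(1)]
    have "?E (\<lambda>M. \<bar>real (isolated_count M) / real n - gamma_CP\<bar>) \<le>
      ?E (\<lambda>M. (\<Sum>N<L. \<bar>iso_count n N M / real n - 2 * iso_density N\<bar>) + (1 - (\<Sum>N<L. arc_count n N M / real n))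
         + \<bar>(\<Sum>N<L. 2 * iso_density N) - gamma_CP\<bar>)"
    proof (rule expectation_mono_CP[OF n1(1)])
      fix M assume M: "perfect_matching {1..2*n} M"
      have split: "(\<Sum>N<2*n. f N) = (\<Sum>N<L. f N) + (\<Sum>N\<in>{L..<2*n}. f N)" for f :: "nat \<Rightarrow> real"
        using sum.union_disjoint[of "{..<L}" "{L..<2*n}" f] n1(2) by (simp add: ivl_disj_un ivl_disj_int)
      \<comment> \<open>The long isolated arcs. As the total is exactly n, the lower bound for short
        arcs becomes an upper bound for these.\<close>
      define t where "t = (\<Sum>N\<in>{L..<2*n}. iso_count n N M) / real n"
      have t0: "0 \<le> t" unfolding t_def by (intro divide_nonneg_nonneg sum_nonneg iso_count_nonneg) simp
      have "t \<le> (\<Sum>N\<in>{L..<2*n}. arc_count n N M) / real n"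
        unfolding t_def by (intro divide_right_mono sum_mono iso_count_le_arc_count) simp
      also have "\<dots> = (real n - (\<Sum>N<L. arc_count n N M)) / real n"
        using split[of "\<lambda>N. arc_count n N M"] sum_arc_count[OF M] by simp
      also have "\<dots> = 1 - (\<Sum>N<L. arc_count n N M / real n)"
        using n1(1) by (simp add: diff_divide_distrib sum_divide_distrib)
      finally have t1: "t \<le> 1 - (\<Sum>N<L. arc_count n N M / real n)" .
      have "real (isolated_count M) / real n - gamma_CP =
          (\<Sum>N<L. iso_count n N M / real n - 2 * iso_density N) + t + ((\<Sum>N<L. 2 * iso_density N) - gamma_CP)"
        unfolding isolated_count_eq[OF M] split t_def
        by (simp add: add_divide_distrib sum_divide_distrib sum_subtractf)
      moreover have "\<bar>\<Sum>N<L. iso_count n N M / real n - 2 * iso_density N\<bar> \<le> (\<Sum>N<L. \<bar>iso_count n N M / real n - 2 * iso_density N\<bar>)"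
        by (rule sum_abs)
      ultimately show "\<bar>real (isolated_count M) / real n - gamma_CP\<bar> \<le>
        (\<Sum>N<L. \<bar>iso_count n N M / real n - 2 * iso_density N\<bar>) + (1 - (\<Sum>N<L. arc_count n N M / real n))
         + \<bar>(\<Sum>N<L. 2 * iso_density N) - gamma_CP\<bar>"
        using t0 t1 by linarith
    qed
    also have "\<dots> = T n" unfolding T_def by (simp add: int)
    also have "\<dots> < \<epsilon>" using n0[of n] n by simp
    finally have "?E (\<lambda>M. \<bar>real (isolated_count M) / real n - gamma_CP\<bar>) < \<epsilon>" .
    moreover have "0 \<le> ?E (\<lambda>M. \<bar>real (isolated_count M) / real n - gamma_CP\<bar>)"
      by (rule Bochner_Integration.integral_nonneg) simp
    ultimately show ?thesis by simp
  qed
  then show "\<exists>no. \<forall>n\<ge>no. norm (measure_pmf.expectation (CP n) (\<lambda>M. \<bar>real (isolated_count M) / real n - gamma_CP\<bar>) - 0) < \<epsilon>"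
    by blast
qed

theorem theorem1p2:
  shows "((\<lambda>n. measure_pmf.expectation (CP n) (\<lambda>M. real (isolated_count M)))
            \<sim>[at_top] (\<lambda>n. gamma_CP * real n)) \<and>
         (\<forall>\<epsilon>>0. (\<lambda>n. measure_pmf.prob (CP n)
            {M. \<bar>real (isolated_count M) - gamma_CP * real n\<bar> < \<epsilon> * real n})
          \<longlonglongrightarrow> 1)"
proof (intro conjI allI impI)
  let ?E = "\<lambda>n. measure_pmf.expectation (CP n)"
  define d where "d = (\<lambda>n. ?E n (\<lambda>M. \<bar>real (isolated_count M) / real n - gamma_CP\<bar>))"
  have d: "d \<longlonglongrightarrow> 0" unfolding d_def by (rule isolated_count_L1)
  have "(\<lambda>n. ?E n (\<lambda>M. real (isolated_count M)) / real n - gamma_CP) \<longlonglongrightarrow> 0"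
  proof (rule Lim_null_comparison[OF _ d])
    show "\<forall>\<^sub>F n in sequentially. norm (?E n (\<lambda>M. real (isolated_count M)) / real n - gamma_CP) \<le> d n"
      using eventually_ge_at_top[of 1]
    proof eventually_elim
      case (elim n)
      have "?E n (\<lambda>M. real (isolated_count M)) / real n - gamma_CP = ?E n (\<lambda>M. real (isolated_count M) / real n - gamma_CP)"
        by (simp add: integrable_CP[OF elim])
      then show ?case unfolding d_def by (simp add: integral_abs_bound)
    qed
  qed
  then have "(\<lambda>n. ?E n (\<lambda>M. real (isolated_count M)) / real n) \<longlonglongrightarrow> gamma_CP" by (simp add: LIM_zero_iff)
  then have "(\<lambda>n. ?E n (\<lambda>M. real (isolated_count M)) / real n / gamma_CP) \<longlonglongrightarrow> gamma_CP / gamma_CP"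
    by (intro tendsto_divide tendsto_const) (use gamma_CP_pos in simp_all)
  then have "(\<lambda>n. ?E n (\<lambda>M. real (isolated_count M)) / (gamma_CP * real n)) \<longlonglongrightarrow> 1"
    using gamma_CP_pos by (simp add: mult.commute)
  then show "(\<lambda>n. ?E n (\<lambda>M. real (isolated_count M))) \<sim>[at_top] (\<lambda>n. gamma_CP * real n)"
    by (rule asymp_equivI')
next
  fix \<epsilon> :: real assume \<epsilon>: "\<epsilon> > 0"
  let ?E = "\<lambda>n. measure_pmf.expectation (CP n)"
  define d where "d = (\<lambda>n. ?E n (\<lambda>M. \<bar>real (isolated_count M) / real n - gamma_CP\<bar>))"
  define A where "A = (\<lambda>n. {M. \<bar>real (isolated_count M) - gamma_CP * real n\<bar> < \<epsilon> * real n})"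
  have "(\<lambda>n. 1 - d n / \<epsilon>) \<longlonglongrightarrow> 1 - 0 / \<epsilon>"
    unfolding d_def by (intro tendsto_diff tendsto_divide tendsto_const isolated_count_L1) (use \<epsilon> in simp)
  then have lim: "(\<lambda>n. 1 - d n / \<epsilon>) \<longlonglongrightarrow> 1" by simp
  have "(\<lambda>n. measure_pmf.prob (CP n) (A n)) \<longlonglongrightarrow> 1"
  proof (rule tendsto_sandwich[OF _ _ lim tendsto_const])
    show "\<forall>\<^sub>F n in sequentially. 1 - d n / \<epsilon> \<le> measure_pmf.prob (CP n) (A n)"
      using eventually_ge_at_top[of 1]
    proof eventually_elim
      case (elim n)
      note int = integrable_CP[OF elim]
      \<comment> \<open>Markov's inequality, as a pointwise comparison with the indicator of the
        good event.\<close>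
      have "1 - d n / \<epsilon> = ?E n (\<lambda>M. 1 - \<bar>real (isolated_count M) / real n - gamma_CP\<bar> / \<epsilon>)"
        unfolding d_def by (simp add: int)
      also have "\<dots> \<le> ?E n (indicator (A n))"
      proof (rule integral_mono[OF int int])
        fix M
        have "\<bar>real (isolated_count M) / real n - gamma_CP\<bar> = \<bar>real (isolated_count M) - gamma_CP * real n\<bar> / real n"
          using elim by (simp add: field_simps flip: abs_divide[of _ "real n", simplified])
        then have "\<epsilon> \<le> \<bar>real (isolated_count M) / real n - gamma_CP\<bar>" if "M \<notin> A n"
          using that elim by (simp add: A_def field_simps)
        then show "1 - \<bar>real (isolated_count M) / real n - gamma_CP\<bar> / \<epsilon> \<le> indicator (A n) M"
          using \<epsilon> by (cases "M \<in> A n") simp_all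
      qed
      also have "\<dots> = measure_pmf.prob (CP n) (A n)" by simp
      finally show ?case .
    qed
  qed simp
  then show "(\<lambda>n. measure_pmf.prob (CP n)
            {M. \<bar>real (isolated_count M) - gamma_CP * real n\<bar> < \<epsilon> * real n}) \<longlonglongrightarrow> 1"
    unfolding A_def .
qed

end
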